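(* Let $\lambda\in(0,1)$. The system $((0,1],F_\lambda)$ has an acip $\mu$ if and only if $\lambda\in(0,\frac12)$, and in this case $$\mu(W_i)=\frac{1-2\lambda}{\lambda}\left(\frac{\lambda}{1-\lambda}\right)^i\qquad\text{for all }i\ge1.$$ If $\lambda\in(\frac12,1)$, then Lebesgue measure is dissipative for $F_\lambda$.
   Context: For $\lambda\in(0,1)$ and $n\ge1$ let $W_n:=(\lambda^n,\lambda^{n-1}]$, and define $F=F_\lambda:(0,1]\to(0,1]$ by $F_\lambda(x)=\frac{x-\lambda}{1-\lambda}$ if $x\in W_1$ and $F_\lambda(x)=\frac{x-\lambda^n}{\lambda(1-\lambda)}$ if $x\in W_n$, $n\ge2$. An acip is an $F_\lambda$-invariant probability measure that is absolutely continuous with respect to Lebesgue measure on $(0,1]$. A measurable set $W$ is wandering if the sets $F^{-n}(W)$, $n\ge0$, are pairwise disjoint. A non-singular measure $m$ is dissipative if, up to an $m$-null set, the whole space is a countable union of wandering sets. *)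

theory Defs
  imports "HOL-Probability.Probability"
begin

text \<open>
  The sets \<open>W lam n\<close> are only meant for \<open>n \<ge> 1\<close>, so the subtraction on naturals does not truncate.
\<close>
definition W :: "real \<Rightarrow> nat \<Rightarrow> real set" where
  "W lam n = {lam ^ n <.. lam ^ (n - 1)}"

text \<open>
  For \<open>0 < lam < 1\<close> the sets \<open>W lam n\<close>, \<open>n \<ge> 1\<close>, partition \<open>{0<..1}\<close>, so the description below
  is proper for every \<open>x\<close> in that interval (see \<open>W_index_eq\<close>, \<open>UN_W\<close>). The values of \<open>F lam\<close>
  outside \<open>{0<..1}\<close> are irrelevant.
\<close>
definition W_index :: "real \<Rightarrow> real \<Rightarrow> nat" where
  "W_index lam x = (THE n. 1 \<le> n \<and> x \<in> W lam n)"

definition F :: "real \<Rightarrow> real \<Rightarrow> real" where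
  "F lam x =
     (if x \<in> W lam 1 then (x - lam) / (1 - lam)
      else (x - lam ^ W_index lam x) / (lam * (1 - lam)))"

definition leb_unit :: "real measure" where
  "leb_unit = restrict_space lborel {0<..1}"

definition invariant_measure :: "('a \<Rightarrow> 'a) \<Rightarrow> 'a measure \<Rightarrow> bool" where
  "invariant_measure T \<mu> \<longleftrightarrow> T \<in> measurable \<mu> \<mu> \<and> distr \<mu> \<mu> T = \<mu>"

definition acip :: "'a measure \<Rightarrow> ('a \<Rightarrow> 'a) \<Rightarrow> 'a measure \<Rightarrow> bool" where
  "acip m T \<mu> \<longleftrightarrow>
     prob_space \<mu> \<and> sets \<mu> = sets m \<and> absolutely_continuous m \<mu> \<and> invariant_measure T \<mu>"

definition nonsingular :: "'a measure \<Rightarrow> ('a \<Rightarrow> 'a) \<Rightarrow> bool" where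
  "nonsingular m T \<longleftrightarrow>
     T \<in> measurable m m \<and>
     (\<forall>A\<in>sets m. T -` A \<inter> space m \<in> null_sets m \<longleftrightarrow> A \<in> null_sets m)"

definition wandering :: "'a measure \<Rightarrow> ('a \<Rightarrow> 'a) \<Rightarrow> 'a set \<Rightarrow> bool" where
  "wandering m T A \<longleftrightarrow>
     A \<in> sets m \<and> disjoint_family (\<lambda>n. (T ^^ n) -` A \<inter> space m)"

definition dissipative :: "'a measure \<Rightarrow> ('a \<Rightarrow> 'a) \<Rightarrow> bool" where
  "dissipative m T \<longleftrightarrow>
     nonsingular m T \<and>
     (\<exists>\<W>. countable \<W> \<and> (\<forall>A\<in>\<W>. wandering m T A) \<and> space m - \<Union>\<W> \<in> null_sets m)"

lemma W_index_eq:
  assumes l: "0 < lam" "lam < 1" and n: "1 \<le> n" and x: "x \<in> W lam n"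
  shows "W_index lam x = n"
  unfolding W_index_def
proof (rule the_equality)
  fix k assume k: "1 \<le> k \<and> x \<in> W lam k"
  have "lam ^ n < lam ^ (k - 1)" "lam ^ k < lam ^ (n - 1)"
    using x k by (auto simp: W_def)
  then have "k - 1 < n" "n - 1 < k"
    using l by (simp_all add: power_strict_decreasing_iff)
  with k n show "k = n" by linarith
qed (use n x in simp)

lemma UN_W:
  assumes l: "0 < lam" "lam < 1"
  shows "(\<Union>n\<in>{1..}. W lam n) = {0<..1}"
proof (intro subset_antisym subsetI)
  fix x assume "x \<in> (\<Union>n\<in>{1..}. W lam n)"
  then obtain n where "lam ^ n < x" "x \<le> lam ^ (n - 1)" by (auto simp: W_def)
  moreover have "0 < lam ^ n" "lam ^ (n - 1) \<le> 1" using l by (auto intro: power_le_one)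
  ultimately show "x \<in> {0<..1}" by auto
next
  fix x :: real assume x: "x \<in> {0<..1}"
  define n where "n = (LEAST n. lam ^ n < x)"
  have "\<exists>n. lam ^ n < x" using x l real_arch_pow_inv[of x lam] by auto
  then have 1: "lam ^ n < x" unfolding n_def by (rule LeastI_ex)
  then have 2: "1 \<le> n" using x by (cases n) auto
  then have "\<not> lam ^ (n - 1) < x" unfolding n_def by (intro not_less_Least) (auto simp: n_def)
  with 1 2 show "x \<in> (\<Union>n\<in>{1..}. W lam n)" by (auto simp: W_def intro!: bexI[of _ n])
qed

lemma F_W1: "x \<in> W lam 1 \<Longrightarrow> F lam x = (x - lam) / (1 - lam)"
  by (simp add: F_def)

lemma F_W:
  assumes "0 < lam" "lam < 1" "2 \<le> n" "x \<in> W lam n"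
  shows "F lam x = (x - lam ^ n) / (lam * (1 - lam))"
proof -
  have "x \<notin> W lam 1"
    using W_index_eq[of lam 1 x] W_index_eq[of lam n x] assms by auto
  then show ?thesis using W_index_eq[of lam n x] assms by (simp add: F_def)
qed

end

theory Submission
  imports Defs
begin

text \<open>
  Seen through the partition into the sets \<open>W lam n\<close>, the map is a random walk whose steps are
  \<open>-1\<close> plus a geometric variable of mean \<open>lam / (1 - lam)\<close>. For \<open>lam > 1/2\<close> it drifts to
  infinity: a Lyapunov function decays geometrically in mean, so almost every orbit visits its own
  cell finitely often, and the preimages of the points that never return to their cell are
  wandering and exhaust the space.

  For invariant measures the point is that every invariant density is constant on each cell. If
  \<open>\<phi>\<close> is bounded with mean zero on every cell, then the primitive of \<open>\<phi> \<circ> F^n\<close> vanishes at all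
  \<open>lam ^ i\<close> and its supremum contracts by \<open>1 - lam\<close> in each step; hence \<open>\<phi> \<circ> F^n\<close> tends weakly to
  \<open>0\<close> and \<open>\<phi>\<close> integrates to \<open>0\<close> against every acip. The cell averages of the density then
  satisfy a linear recurrence with solution \<open>h (k + 1) = h 1 / (1 - lam) ^ k\<close>, which is
  normalisable exactly for \<open>lam < 1/2\<close>.
\<close>

section \<open>Dissipativity and weak null sequences\<close>

lemma measurable_funpow: "T \<in> measurable m m \<Longrightarrow> T ^^ n \<in> measurable m m"
  by (induction n) (auto simp: id_def)

text \<open>The \<open>k\<close>-th preimage of the new set is the \<open>(n + k)\<close>-th
  preimage of \<open>A\<close>, so the new family is a tail of a disjoint one.\<close>

lemma wandering_vimage:
  assumes T: "T \<in> measurable m m" and A: "wandering m T A"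
  shows "wandering m T ((T ^^ n) -` A \<inter> space m)"
proof -
  have Tn: "T ^^ k \<in> measurable m m" for k
    by (rule measurable_funpow[OF T])
  have "(T ^^ k) -` ((T ^^ n) -` A \<inter> space m) \<inter> space m = (T ^^ (n + k)) -` A \<inter> space m" for k
    using measurable_space[OF Tn[of k]] by (auto simp: funpow_add)
  moreover have "disjoint_family (\<lambda>k. (T ^^ (n + k)) -` A \<inter> space m)"
    using A unfolding wandering_def disjoint_family_on_def by auto
  ultimately show ?thesis
    using A measurable_sets[OF Tn, of A n] by (simp add: wandering_def)
qed

text \<open>A point in the preimages of order \<open>k < l\<close> would be in \<open>?A\<close> at
  time \<open>k\<close> and back in \<open>B\<close> after \<open>l - k > 0\<close> further
  steps.\<close>

lemma wandering_never_returning: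
  assumes T: "T \<in> measurable m m" and B: "B \<in> sets m"
  shows "wandering m T {x \<in> B. \<forall>n. (T ^^ Suc n) x \<notin> B}" (is "wandering m T ?A")
proof -
  have Tn: "T ^^ k \<in> measurable m m" for k
    by (rule measurable_funpow[OF T])
  have "?A = B - (\<Union>n. (T ^^ Suc n) -` B \<inter> space m)"
    using sets.sets_into_space[OF B] by auto
  then have "?A \<in> sets m"
    using B measurable_sets[OF Tn B]
    by (simp only:) (intro sets.Diff sets.countable_UN, simp_all del: funpow.simps add: image_subset_iff)
  moreover have disj: "(T ^^ k) -` ?A \<inter> (T ^^ l) -` ?A = {}" if kl: "k < l" for k l
  proof -
    obtain d where "l = Suc (k + d)" using less_imp_Suc_add[OF kl] by blast
    \<comment> \<open>In this order \<open>funpow_add\<close> applies the first \<open>k\<close>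
      steps innermost, so the remaining \<open>Suc d\<close> steps start at a point of
      \<open>?A\<close>.\<close>
    then have "l = Suc d + k" by simp
    then have l: "(T ^^ l) x = (T ^^ Suc d) ((T ^^ k) x)" for x by (simp only: funpow_add comp_apply)
    show ?thesis
    proof (rule equals0I)
      fix x assume "x \<in> (T ^^ k) -` ?A \<inter> (T ^^ l) -` ?A"
      then have "\<forall>n. (T ^^ Suc n) ((T ^^ k) x) \<notin> B" "(T ^^ l) x \<in> B"
        unfolding Int_iff vimage_eq mem_Collect_eq by - (elim conjE, assumption)+
      then show False unfolding l by (elim allE) (erule notE)
    qed
  qed
  have "disjoint_family (\<lambda>n. (T ^^ n) -` ?A \<inter> space m)"
    unfolding disjoint_family_on_def
  proof (intro ballI impI)
    fix k l :: nat assume "k \<noteq> l"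
    then have "(T ^^ k) -` ?A \<inter> (T ^^ l) -` ?A = {}"
    proof (cases k l rule: linorder_cases)
      case less
      then show ?thesis by (rule disj)
    next
      case greater
      then show ?thesis by (subst Int_commute) (rule disj)
    qed simp
    then show "((T ^^ k) -` ?A \<inter> space m) \<inter> ((T ^^ l) -` ?A \<inter> space m) = {}"
      by (simp only: Int_assoc Int_left_commute[of "space m"])
         (simp only: Int_assoc[symmetric] Int_empty_left)
  qed
  ultimately show ?thesis by (simp add: wandering_def)
qed

text \<open>At the time of its last visit to \<open>B\<close> the orbit is in the part of
  \<open>B\<close> that never returns. Hence almost every point lies in some preimage of such a
  part. These preimages are wandering, and there are countably many of them.\<close>

lemma dissipativeI_finite_visits:
  assumes ns: "nonsingular m T" and C: "countable C" "C \<subseteq> sets m"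
    and fin: "AE x in m. \<exists>B\<in>C. x \<in> B \<and> finite {n. (T ^^ n) x \<in> B}"
  shows "dissipative m T"
proof -
  have T: "T \<in> measurable m m" using ns by (simp add: nonsingular_def)
  define A where "A B = {x \<in> B. \<forall>n. (T ^^ Suc n) x \<notin> B}" for B
  define \<W> where "\<W> = (\<lambda>(n, B). (T ^^ n) -` A B \<inter> space m) ` (UNIV \<times> C)"
  have wand: "wandering m T X" if "X \<in> \<W>" for X
  proof -
    obtain n B where X: "X = (T ^^ n) -` A B \<inter> space m" "B \<in> C"
      using \<open>X \<in> \<W>\<close> by (auto simp: \<W>_def)
    then have "wandering m T (A B)"
      unfolding A_def using C by (intro wandering_never_returning[OF T]) blast
    then show ?thesis unfolding X by (rule wandering_vimage[OF T])
  qed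
  have "countable \<W>" unfolding \<W>_def using C by auto
  then have meas: "space m - \<Union>\<W> \<in> sets m"
    using wand by (intro sets.Diff sets.top sets.countable_Union) (auto simp: wandering_def)
  have "AE x in m. x \<notin> space m - \<Union>\<W>"
    using fin
  proof eventually_elim
    fix x assume "\<exists>B\<in>C. x \<in> B \<and> finite {n. (T ^^ n) x \<in> B}"
    then obtain B where B: "B \<in> C" "x \<in> B" and f: "finite {n. (T ^^ n) x \<in> B}" by auto
    define n where "n = Max {n. (T ^^ n) x \<in> B}"
    \<comment> \<open>Time \<open>0\<close> is a visit, so the maximum is a genuine last
      visit.\<close>
    have "{n. (T ^^ n) x \<in> B} \<noteq> {}" using B by (auto intro!: exI[of _ 0])
    from Max_in[OF f this] have 1: "(T ^^ n) x \<in> B" by (simp add: n_def)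
    have "(T ^^ Suc k) ((T ^^ n) x) \<notin> B" for k
    proof
      assume "(T ^^ Suc k) ((T ^^ n) x) \<in> B"
      then have "(T ^^ (Suc k + n)) x \<in> B" by (simp only: funpow_add comp_apply)
      then have "Suc k + n \<le> n" unfolding n_def using f by (intro Max_ge) auto
      then show False by simp
    qed
    with 1 have "(T ^^ n) x \<in> A B" by (simp only: A_def mem_Collect_eq) simp
    then show "x \<notin> space m - \<Union>\<W>"
      using B unfolding \<W>_def by blast
  qed
  then have "space m - \<Union>\<W> \<in> null_sets m"
    using meas by (subst AE_iff_null_sets) auto
  with \<open>countable \<W>\<close> wand ns show ?thesis unfolding dissipative_def by blast
qed

text \<open>The uniform bound makes the functionals given by \<open>\<psi> n\<close> equicontinuous
  in the L1 norm, so the class \<open>P\<close> of admissible \<open>h\<close> is closed under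
  dominated limits. A Dynkin argument carries \<open>P\<close> from the generator to all indicators,
  and induction over integrable functions does the rest.\<close>

lemma weak_null_L1:
  fixes \<psi> :: "nat \<Rightarrow> 'a \<Rightarrow> real"
  assumes "finite_measure M"
    and gen: "sets M = sigma_sets (space M) E" "Int_stable E" "E \<subseteq> Pow (space M)"
    and meas: "\<And>n. \<psi> n \<in> borel_measurable M"
    and bound: "\<And>n x. x \<in> space M \<Longrightarrow> \<bar>\<psi> n x\<bar> \<le> C"
    and lim_E: "\<And>A. A \<in> E \<Longrightarrow> (\<lambda>n. \<integral>x. indicator A x * \<psi> n x \<partial>M) \<longlonglongrightarrow> 0"
    and lim_space: "(\<lambda>n. \<integral>x. \<psi> n x \<partial>M) \<longlonglongrightarrow> 0"
    and h: "integrable M h"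
  shows "(\<lambda>n. \<integral>x. h x * \<psi> n x \<partial>M) \<longlonglongrightarrow> 0"
proof -
  interpret finite_measure M by fact
  note meas [measurable]
  define P where "P h \<longleftrightarrow> (\<lambda>n. \<integral>x. h x * \<psi> n x \<partial>M) \<longlonglongrightarrow> 0" for h :: "'a \<Rightarrow> real"
  have int: "integrable M (\<lambda>x. h x * \<psi> n x)" if "integrable M h" for h n
  proof (rule Bochner_Integration.integrable_bound)
    \<comment> \<open>No sign of \<open>C\<close> is assumed, so the majorants use its absolute
      value.\<close>
    show "integrable M (\<lambda>x. \<bar>C\<bar> * \<bar>h x\<bar>)" using that by simp
    show "AE x in M. norm (h x * \<psi> n x) \<le> norm (\<bar>C\<bar> * \<bar>h x\<bar>)"
      using order_trans[OF bound abs_ge_self, of _ n]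
      by (intro AE_I2) (auto simp: abs_mult mult.commute[of "\<bar>C\<bar>"] intro!: mult_left_mono)
  qed (use that in measurable)
  have P_add: "P (\<lambda>x. f x + g x)" if "integrable M f" "P f" "integrable M g" "P g" for f g
    using tendsto_add[of "\<lambda>n. \<integral>x. f x * \<psi> n x \<partial>M" 0 sequentially "\<lambda>n. \<integral>x. g x * \<psi> n x \<partial>M" 0] that
    by (simp add: P_def distrib_right int)
  have P_lim: "P f" if s: "\<And>i. integrable M (s i)" "\<And>i. P (s i)"
    "\<And>x. x \<in> space M \<Longrightarrow> (\<lambda>i. s i x) \<longlonglongrightarrow> f x" and w: "integrable M w"
    "\<And>i x. x \<in> space M \<Longrightarrow> \<bar>s i x\<bar> \<le> w x" and f: "integrable M f" for f w and s :: "nat \<Rightarrow> 'a \<Rightarrow> real"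
  proof -
    have [measurable]: "f \<in> borel_measurable M" "\<And>i. s i \<in> borel_measurable M" using s f by auto
    have "(\<lambda>i. \<integral>x. \<bar>s i x - f x\<bar> \<partial>M) \<longlonglongrightarrow> (\<integral>x. 0 \<partial>M)"
    proof (rule integral_dominated_convergence[where w="\<lambda>x. w x + \<bar>f x\<bar>"])
      show "AE x in M. (\<lambda>i. \<bar>s i x - f x\<bar>) \<longlonglongrightarrow> 0"
        using s(3) by (intro AE_I2 tendsto_rabs_zero) (simp add: LIM_zero)
      show "AE x in M. norm \<bar>s i x - f x\<bar> \<le> w x + \<bar>f x\<bar>" for i
      proof (rule AE_I2)
        fix x assume "x \<in> space M"
        from w(2)[OF this, of i] show "norm \<bar>s i x - f x\<bar> \<le> w x + \<bar>f x\<bar>" by simp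
      qed
    qed (use w f in auto)
    then have L: "(\<lambda>i. \<bar>C\<bar> * (\<integral>x. \<bar>s i x - f x\<bar> \<partial>M)) \<longlonglongrightarrow> 0"
      by (intro tendsto_mult_right_zero) simp
    \<comment> \<open>The right-hand side is independent of \<open>n\<close>; below,
      \<open>i\<close> is therefore fixed first and \<open>n\<close> goes to infinity
      afterwards.\<close>
    have diff: "\<bar>(\<integral>x. f x * \<psi> n x \<partial>M) - (\<integral>x. s i x * \<psi> n x \<partial>M)\<bar> \<le> \<bar>C\<bar> * (\<integral>x. \<bar>s i x - f x\<bar> \<partial>M)" for i n
    proof -
      have "(\<integral>x. f x * \<psi> n x \<partial>M) - (\<integral>x. s i x * \<psi> n x \<partial>M) = (\<integral>x. (f x - s i x) * \<psi> n x \<partial>M)"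
        using s f by (simp add: left_diff_distrib int)
      also have "\<bar>\<dots>\<bar> \<le> (\<integral>x. \<bar>(f x - s i x) * \<psi> n x\<bar> \<partial>M)"
        by (rule integral_abs_bound)
      also have "\<dots> \<le> (\<integral>x. \<bar>C\<bar> * \<bar>s i x - f x\<bar> \<partial>M)"
      proof (rule integral_mono)
        show "integrable M (\<lambda>x. \<bar>(f x - s i x) * \<psi> n x\<bar>)" using s f by (intro integrable_abs int) auto
        show "\<bar>(f x - s i x) * \<psi> n x\<bar> \<le> \<bar>C\<bar> * \<bar>s i x - f x\<bar>" if "x \<in> space M" for x
          using order_trans[OF bound[OF that] abs_ge_self, of n]
          by (auto simp: abs_mult mult.commute[of "\<bar>C\<bar>"] abs_minus_commute intro!: mult_left_mono)
      qed (use s f in auto)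
      finally show ?thesis by simp
    qed
    show ?thesis
      unfolding P_def
    proof (rule LIMSEQ_I)
      fix e :: real assume e: "0 < e"
      obtain i where i: "\<bar>C\<bar> * (\<integral>x. \<bar>s i x - f x\<bar> \<partial>M) < e / 2"
        using order_tendstoD(2)[OF L, of "e / 2"] e by (auto simp: eventually_sequentially)
      obtain N where "\<And>n. N \<le> n \<Longrightarrow> \<bar>\<integral>x. s i x * \<psi> n x \<partial>M\<bar> < e / 2"
        using LIMSEQ_D[OF s(2)[of i, unfolded P_def], of "e / 2"] e by auto
      then have "\<forall>n\<ge>N. norm ((\<integral>x. f x * \<psi> n x \<partial>M) - 0) < e"
        using diff[of _ i] i by (smt (verit) field_sum_of_halves real_norm_def)
      then show "\<exists>N. \<forall>n\<ge>N. norm ((\<integral>x. f x * \<psi> n x \<partial>M) - 0) < e" by blast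
    qed
  qed
  have P_ind: "P (indicator A)" if "A \<in> sets M" for A
  proof -
    have "A \<in> sigma_sets (space M) E" using that gen by simp
    with gen(2,3) show ?thesis
    proof (induction rule: sigma_sets_induct_disjoint)
      case (basic A)
      then show ?case using lim_E by (simp add: P_def)
    next
      case empty
      then show ?case by (simp add: P_def)
    next
      case (compl A)
      then have [measurable]: "A \<in> sets M" by (simp add: gen(1))
      \<comment> \<open>Complements reduce to the whole space, which is where
        \<open>lim_space\<close> enters.\<close>
      have "(\<integral>x. indicator (space M - A) x * \<psi> n x \<partial>M) = (\<integral>x. \<psi> n x \<partial>M) - (\<integral>x. indicator A x * \<psi> n x \<partial>M)" for n
      proof -
        have "(\<integral>x. indicator (space M - A) x * \<psi> n x \<partial>M) = (\<integral>x. 1 * \<psi> n x - indicator A x * \<psi> n x \<partial>M)"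
          by (intro Bochner_Integration.integral_cong) (auto split: split_indicator)
        also have "\<dots> = (\<integral>x. 1 * \<psi> n x \<partial>M) - (\<integral>x. indicator A x * \<psi> n x \<partial>M)"
          by (intro Bochner_Integration.integral_diff int) (auto simp: emeasure_eq_measure)
        finally show ?thesis by simp
      qed
      then show ?case
        using tendsto_diff[OF lim_space compl(2)[unfolded P_def]] by (simp add: P_def)
    next
      case (union A)
      then have [measurable]: "\<And>i. A i \<in> sets M" by (auto simp: gen(1))
      have fin: "integrable M (\<lambda>x. \<Sum>i<k. indicator (A i) x :: real)" for k
        by (auto simp: emeasure_eq_measure)
      show ?case
      proof (rule P_lim[where s="\<lambda>k x. \<Sum>i<k. indicator (A i) x" and w="\<lambda>_. 1"])
        show "P (\<lambda>x. \<Sum>i<k. indicator (A i) x)" for k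
        proof (induction k)
          case (Suc k)
          then show ?case using P_add[OF fin[of k], of "indicator (A k)"] union(3)[of k]
            by (simp add: emeasure_eq_measure)
        qed (simp add: P_def)
        show "(\<lambda>k. \<Sum>i<k. indicator (A i) x) \<longlonglongrightarrow> (indicator (\<Union>(range A)) x :: real)" for x
          using indicator_sums[of A x] union(1) by (auto simp: sums_def disjoint_family_on_def)
        \<comment> \<open>By disjointness the partial sum is itself the indicator of a finite
          union.\<close>
        show "\<bar>\<Sum>i<k. indicator (A i) x :: real\<bar> \<le> 1" for k x
          using union(1) by (subst indicator_UN_disjoint[symmetric]) (auto simp: disjoint_family_on_def indicator_def)
      qed (use fin in \<open>auto simp: emeasure_eq_measure\<close>)
    qed
  qed
  have "P h"
    using h
  proof induction
    case (base A c)
    have "(\<lambda>n. c * (\<integral>x. indicator A x * \<psi> n x \<partial>M)) \<longlonglongrightarrow> 0"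
      using P_ind[OF base(1)] by (intro tendsto_mult_right_zero) (simp add: P_def)
    then show ?case by (simp add: P_def ac_simps)
  next
    case (add f g)
    then show ?case by (intro P_add)
  next
    case (lim f s)
    show ?case by (rule P_lim[where s=s and w="\<lambda>x. 2 * norm (f x)"]) (use lim in auto)
  qed
  then show ?thesis by (simp add: P_def)
qed

section \<open>The branches of the map\<close>

lemma space_leb_unit [simp]: "space leb_unit = {0<..1}"
  by (simp add: leb_unit_def space_restrict_space)

lemma sets_leb_unit_iff: "A \<in> sets leb_unit \<longleftrightarrow> A \<subseteq> {0<..1} \<and> A \<in> sets borel"
  by (simp add: leb_unit_def sets_restrict_space_iff)

lemma emeasure_leb_unit: "A \<subseteq> {0<..1} \<Longrightarrow> emeasure leb_unit A = emeasure lborel A"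
  by (simp add: leb_unit_def emeasure_restrict_space)

lemma null_sets_leb_unit_iff: "A \<in> null_sets leb_unit \<longleftrightarrow> A \<subseteq> {0<..1} \<and> A \<in> null_sets lborel"
  by (simp add: leb_unit_def null_sets_restrict_space)

lemma measurable_leb_unit: "f \<in> borel_measurable borel \<Longrightarrow> f \<in> borel_measurable leb_unit"
  unfolding leb_unit_def by (intro measurable_restrict_space1) simp

text \<open>This supplies the generator for \<open>weak_null_L1\<close>: weak convergence to zero
  then only has to be tested on intervals that start at \<open>0\<close>, that is, on
  primitives.\<close>

lemma sets_leb_unit_generator:
  "sets leb_unit = sigma_sets (space leb_unit) ((\<inter>) {0<..1} ` range atMost)"
proof -
  have "sets leb_unit = (\<inter>) {0<..1} ` sigma_sets UNIV (range atMost)"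
    by (simp add: leb_unit_def sets_restrict_space) (simp add: borel_eq_atMost)
  also have "\<dots> = sigma_sets {0<..1} ((\<inter>) {0<..1} ` range atMost)"
  proof (rule sigma_sets_Int)
    have "{0<..1::real} \<in> sets borel" by simp
    then show "{0<..1::real} \<in> sigma_sets UNIV (range atMost)" by (simp add: borel_eq_atMost)
  qed simp
  finally show ?thesis by simp
qed

lemma integrable_bounded_unit:
  fixes f :: "real \<Rightarrow> real"
  assumes [measurable]: "f \<in> borel_measurable borel" "A \<in> sets borel"
    and f: "\<And>x. \<bar>f x\<bar> \<le> 1" and A: "A \<subseteq> {0<..1}"
  shows "integrable lborel (\<lambda>x. f x * indicator A x)"
proof (rule Bochner_Integration.integrable_bound)
  show "integrable lborel (indicator {0<..1::real} :: real \<Rightarrow> real)" by simp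
  show "AE x in lborel. norm (f x * indicator A x) \<le> norm (indicator {0<..1::real} x :: real)"
    using f A by (intro AE_I2) (auto split: split_indicator)
qed simp

text \<open>The reciprocal of the constant slope of \<open>F lam\<close> on the cell
  \<open>W lam j\<close>, hence the factor by which the inverse branch scales length.\<close>

definition inv_slope :: "real \<Rightarrow> nat \<Rightarrow> real" where
  "inv_slope lam j = (if j = 1 then 1 - lam else lam * (1 - lam))"

text \<open>Subtracting consecutive instances leaves
  \<open>h (k + 1) - h k = lam * (1 - lam) * h (k + 2)\<close>, with characteristic roots
  \<open>1 / lam\<close> and \<open>1 / (1 - lam)\<close>. The instance at \<open>1\<close> plays
  the role of a boundary condition and selects the second root.\<close>

lemma stationary_recurrence:
  fixes h :: "nat \<Rightarrow> real"
  assumes lam: "0 < lam" "lam < 1"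
    and h: "\<And>k. 1 \<le> k \<Longrightarrow> h k = (\<Sum>n=1..Suc k. inv_slope lam n * h n)"
  shows "h (Suc k) = h 1 / (1 - lam) ^ k"
proof -
  \<comment> \<open>The recurrence has order two, so the induction carries two consecutive
    values.\<close>
  have "h (Suc k) = h 1 / (1 - lam) ^ k \<and> h (Suc (Suc k)) = h 1 / (1 - lam) ^ Suc k"
  proof (induction k)
    case 0
    define h2 where "h2 = h (Suc 1)"
    have "h 1 = (1 - lam) * h 1 + lam * (1 - lam) * h2"
      using h[of 1] by (simp add: inv_slope_def h2_def)
    then have "lam * ((1 - lam) * h2) = lam * h 1" by (simp add: algebra_simps)
    then have "(1 - lam) * h2 = h 1" using lam by simp
    then have "h2 = h 1 / (1 - lam)" using lam by (simp add: nonzero_eq_divide_eq mult.commute)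
    then show ?case by (simp add: h2_def)
  next
    case (Suc k)
    have "h (Suc (Suc k)) = (\<Sum>n=1..Suc (Suc (Suc k)). inv_slope lam n * h n)"
      by (rule h) simp
    also have "\<dots> = (\<Sum>n=1..Suc (Suc k). inv_slope lam n * h n) + lam * (1 - lam) * h (Suc (Suc (Suc k)))"
      by (simp add: inv_slope_def)
    also have "(\<Sum>n=1..Suc (Suc k). inv_slope lam n * h n) = h (Suc k)"
      by (rule h[symmetric]) simp
    finally have "h (Suc (Suc k)) = h (Suc k) + lam * (1 - lam) * h (Suc (Suc (Suc k)))" .
    moreover have "h (Suc k) = (1 - lam) * h (Suc (Suc k))"
      using Suc lam by simp
    ultimately have "lam * ((1 - lam) * h (Suc (Suc (Suc k)))) = lam * h (Suc (Suc k))"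
      by (simp add: algebra_simps)
    then have "(1 - lam) * h (Suc (Suc (Suc k))) = h (Suc (Suc k))" using lam by simp
    then have "h (Suc (Suc (Suc k))) = h (Suc (Suc k)) / (1 - lam)"
      using lam by (simp add: nonzero_eq_divide_eq mult.commute)
    then show ?case using Suc by simp
  qed
  then show ?thesis ..
qed

context
  fixes lam :: real
  assumes lam_pos: "0 < lam" and lam_less1: "lam < 1"
begin

section \<open>The partition into cells\<close>

lemma W_measurable [measurable]: "W lam n \<in> sets borel"
  by (simp add: W_def)

lemma W_disjoint: "1 \<le> i \<Longrightarrow> 1 \<le> j \<Longrightarrow> i \<noteq> j \<Longrightarrow> W lam i \<inter> W lam j = {}"
  using W_index_eq[OF lam_pos lam_less1] by blast

lemma W_index_W:
  assumes "x \<in> {0<..1}"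
  shows "1 \<le> W_index lam x" "x \<in> W lam (W_index lam x)"
proof -
  have "x \<in> (\<Union>n\<in>{1..}. W lam n)"
    using assms UN_W[OF lam_pos lam_less1] by simp
  then obtain n where "1 \<le> n" "x \<in> W lam n" by auto
  then show "1 \<le> W_index lam x" "x \<in> W lam (W_index lam x)"
    using W_index_eq[OF lam_pos lam_less1] by auto
qed

lemma W_subset_unit: "1 \<le> n \<Longrightarrow> W lam n \<subseteq> {0<..1}"
  using UN_W[OF lam_pos lam_less1] by auto

lemma W_subset_initial:
  assumes "i < j" shows "W lam j \<subseteq> {0<..lam ^ i}"
proof -
  have "lam ^ (j - 1) \<le> lam ^ i"
    using assms lam_pos lam_less1 by (intro power_decreasing) auto
  then show ?thesis
    using zero_less_power[OF lam_pos, of j] by (auto simp: W_def)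
qed

lemma initial_eq_UN_W: "{0<..lam ^ i} = (\<Union>k. W lam (i + 1 + k))"
proof (intro subset_antisym subsetI)
  fix x assume x: "x \<in> {0<..lam ^ i}"
  have "lam ^ i \<le> 1" using lam_pos lam_less1 by (simp add: power_le_one)
  then have *: "1 \<le> W_index lam x" "x \<in> W lam (W_index lam x)"
    using W_index_W[of x] x by auto
  have "i < W_index lam x"
  proof (rule ccontr)
    assume "\<not> ?thesis"
    then have "lam ^ i \<le> lam ^ W_index lam x"
      using lam_pos lam_less1 by (intro power_decreasing) auto
    with x * show False by (auto simp: W_def)
  qed
  then show "x \<in> (\<Union>k. W lam (i + 1 + k))"
    using * by (intro UN_I[of "W_index lam x - i - 1"]) auto
next
  fix x assume "x \<in> (\<Union>k. W lam (i + 1 + k))"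
  then obtain k where "x \<in> W lam (i + 1 + k)" by blast
  then show "x \<in> {0<..lam ^ i}" using W_subset_initial[of i "i + 1 + k"] by auto
qed

lemma W_disjoint_family: "disjoint_family (\<lambda>k. W lam (i + 1 + k))"
  unfolding disjoint_family_on_def by (intro ballI impI W_disjoint) auto

lemma emeasure_W: "1 \<le> n \<Longrightarrow> emeasure lborel (W lam n) = ennreal (lam ^ (n - 1) * (1 - lam))"
proof -
  assume "1 \<le> n"
  then have "lam ^ (n - 1) - lam ^ n = lam ^ (n - 1) * (1 - lam)"
    by (cases n) (auto simp: algebra_simps)
  moreover have "lam ^ n \<le> lam ^ (n - 1)"
    using lam_pos lam_less1 by (intro power_decreasing) auto
  ultimately show ?thesis by (simp add: W_def)
qed

lemma measure_W: "1 \<le> n \<Longrightarrow> measure lborel (W lam n) = lam ^ (n - 1) * (1 - lam)"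
  using emeasure_W[of n] lam_pos lam_less1 by (simp add: measure_def)

lemma W_index_measurable [measurable]: "W_index lam \<in> borel \<rightarrow>\<^sub>M count_space UNIV"
proof (rule measurable_piecewise_restrict[of "insert (- {0<..1}) (W lam ` {1..})"])
  fix S assume "S \<in> insert (- {0<..1}) (W lam ` {1..})"
  then consider "S = - {0<..1}" | n where "1 \<le> n" "S = W lam n" by auto
  then show "W_index lam \<in> restrict_space borel S \<rightarrow>\<^sub>M count_space UNIV"
  proof cases
    case 1
    \<comment> \<open>Outside the unit interval no index qualifies; the description is then one
      unspecified number, the same for all such points.\<close>
    then have "W_index lam x = (THE n. False)" if "x \<in> S" for x
    proof -
      have "\<And>n. \<not> (1 \<le> n \<and> x \<in> W lam n)" using W_subset_unit 1 that by blast
      then show ?thesis unfolding W_index_def by (intro arg_cong[of _ _ The] ext) blast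
    qed
    then show ?thesis
      by (subst measurable_cong[where g="\<lambda>_. THE n. False"]) (auto simp: space_restrict_space)
  next
    case 2
    then show ?thesis using W_index_eq[OF lam_pos lam_less1]
      by (subst measurable_cong[where g="\<lambda>_. n"]) (auto simp: space_restrict_space)
  qed
  show "S \<inter> space borel \<in> sets borel"
    using \<open>S \<in> _\<close> by auto
qed (use UN_W[OF lam_pos lam_less1] in auto)

lemma F_measurable [measurable]: "F lam \<in> borel_measurable borel"
  unfolding F_def[abs_def] by measurable

lemma F_pow_measurable [measurable]: "F lam ^^ n \<in> borel_measurable borel"
  by (induction n) auto

section \<open>Affine branches and change of variables\<close>

lemma inv_slope_pos: "0 < inv_slope lam j"
  using lam_pos lam_less1 by (simp add: inv_slope_def)

lemma inv_slope_le: "inv_slope lam j \<le> 1 - lam"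
  using lam_pos lam_less1 by (simp add: inv_slope_def)

lemma F_on_W: "1 \<le> j \<Longrightarrow> x \<in> W lam j \<Longrightarrow> F lam x = (x - lam ^ j) / inv_slope lam j"
  using F_W1[of x lam] F_W[OF lam_pos lam_less1, of j x] by (cases "j = 1") (auto simp: inv_slope_def)

lemma top_in_W: "1 \<le> j \<Longrightarrow> lam ^ (j - 1) \<in> W lam j"
  using lam_pos lam_less1 by (cases j) (auto simp: W_def)

text \<open>Truncated subtraction makes the exponent \<open>j - 2\<close> correct for \<open>j = 1\<close> as well.\<close>
lemma F_top:
  assumes "1 \<le> j" shows "F lam (lam ^ (j - 1)) = lam ^ (j - 2)"
proof -
  note top_in_W[OF assms]
  moreover have "lam ^ (j - 1) - lam ^ j = inv_slope lam j * lam ^ (j - 2)"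
  proof (cases "j = 1")
    case False
    then have "j = Suc (Suc (j - 2))" using assms by linarith
    then obtain k where "j = Suc (Suc k)" by blast
    then show ?thesis by (simp add: inv_slope_def algebra_simps)
  qed (simp add: inv_slope_def)
  ultimately show ?thesis
    using F_on_W[OF assms] inv_slope_pos[of j] by simp
qed

text \<open>Each branch is increasing, so its value at the right endpoint is an upper bound. In
  terms of the walk, one step lowers the index by at most one.\<close>

lemma F_W_bounds:
  assumes "1 \<le> j" "x \<in> W lam j"
  shows "F lam x \<in> {0<..lam ^ (j - 2)}"
proof -
  note top_in_W[OF assms(1)]
  then have "F lam x \<le> F lam (lam ^ (j - 1))"
    using F_on_W assms inv_slope_pos[of j] by (auto simp: W_def divide_right_mono)
  then show ?thesis
    using F_on_W[OF assms] F_top assms inv_slope_pos[of j] by (auto simp: W_def)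
qed

lemma F_unit:
  assumes "x \<in> {0<..1}" shows "F lam x \<in> {0<..1}"
proof -
  have "lam ^ (W_index lam x - 2) \<le> 1" using lam_pos lam_less1 by (simp add: power_le_one)
  then show ?thesis
    using F_W_bounds[OF W_index_W[OF assms]] by auto
qed

text \<open>The affine substitution inverting the \<open>j\<close>-th branch, at the level of
  integrands. The value type is a general semiring so that both the nonnegative and the real
  integral can use it.\<close>

lemma indicator_branch:
  assumes "1 \<le> j" "b \<in> W lam j"
  shows "g (F lam (lam ^ j + inv_slope lam j * y)) * indicator {lam ^ j<..b} (lam ^ j + inv_slope lam j * y)
    = (g y * indicator {0<..F lam b} y :: 'a :: semiring_1)"
proof -
  have *: "lam ^ j + inv_slope lam j * y \<in> {lam ^ j<..b} \<longleftrightarrow> y \<in> {0<..F lam b}"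
  proof -
    have "b = lam ^ j + inv_slope lam j * F lam b"
      using F_on_W[OF assms] inv_slope_pos[of j] by simp
    then have "lam ^ j + inv_slope lam j * y \<le> b \<longleftrightarrow> inv_slope lam j * y \<le> inv_slope lam j * F lam b"
      by linarith
    then show ?thesis using inv_slope_pos[of j] by (simp add: zero_less_mult_iff)
  qed
  moreover have "F lam (lam ^ j + inv_slope lam j * y) = y" if "y \<in> {0<..F lam b}"
  proof -
    have "lam ^ j + inv_slope lam j * y \<in> W lam j"
      using * that assms(2) by (auto simp: W_def)
    from F_on_W[OF assms(1) this] show ?thesis using inv_slope_pos[of j] by simp
  qed
  ultimately show ?thesis by (auto simp: indicator_def)
qed

lemma nn_integral_branch:
  assumes [measurable]: "g \<in> borel_measurable borel" and "1 \<le> j" "b \<in> W lam j"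
  shows "(\<integral>\<^sup>+x. g (F lam x) * indicator {lam ^ j<..b} x \<partial>lborel)
    = ennreal (inv_slope lam j) * (\<integral>\<^sup>+y. g y * indicator {0<..F lam b} y \<partial>lborel)"
  using inv_slope_pos[of j]
  by (subst nn_integral_real_affine[where c="inv_slope lam j" and t="lam ^ j"])
     (simp_all add: indicator_branch[OF assms(2,3), where 'a=ennreal])

text \<open>The cut at an arbitrary point \<open>b\<close> of the cell allows primitives to be
  computed at interior points; a whole cell is the case \<open>b = lam ^ (j - 1)\<close>.\<close>

lemma integral_branch:
  fixes g :: "real \<Rightarrow> real"
  assumes "1 \<le> j" "b \<in> W lam j"
  shows "(\<integral>x. g (F lam x) * indicator {lam ^ j<..b} x \<partial>lborel)
    = inv_slope lam j * (\<integral>y. g y * indicator {0<..F lam b} y \<partial>lborel)"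
  using inv_slope_pos[of j]
  by (subst lborel_integral_real_affine[where c="inv_slope lam j" and t="lam ^ j"])
     (simp_all add: indicator_branch[OF assms, where 'a=real])

lemma nn_integral_W:
  assumes "g \<in> borel_measurable borel" "1 \<le> j"
  shows "(\<integral>\<^sup>+x. g (F lam x) * indicator (W lam j) x \<partial>lborel)
    = ennreal (inv_slope lam j) * (\<integral>\<^sup>+y. g y * indicator {0<..lam ^ (j - 2)} y \<partial>lborel)"
  using nn_integral_branch[OF assms(1,2) top_in_W] F_top assms by (simp add: W_def)

lemma integral_W:
  fixes g :: "real \<Rightarrow> real"
  assumes "1 \<le> j"
  shows "(\<integral>x. g (F lam x) * indicator (W lam j) x \<partial>lborel)
    = inv_slope lam j * (\<integral>y. g y * indicator {0<..lam ^ (j - 2)} y \<partial>lborel)"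
  using integral_branch[OF assms top_in_W] F_top assms by (simp add: W_def)

text \<open>For a cell \<open>A\<close> this is, up to division by the length of
  \<open>W lam j\<close>, the transition law of the random walk.\<close>

lemma emeasure_F_vimage_W:
  assumes [measurable]: "A \<in> sets borel" and "1 \<le> j"
  shows "emeasure lborel (F lam -` A \<inter> W lam j)
    = ennreal (inv_slope lam j) * emeasure lborel (A \<inter> {0<..lam ^ (j - 2)})"
proof -
  have [measurable]: "F lam -` A \<in> sets borel"
    using measurable_sets[OF F_measurable assms(1)] by simp
  have "emeasure lborel (F lam -` A \<inter> W lam j) = (\<integral>\<^sup>+x. indicator (F lam -` A \<inter> W lam j) x \<partial>lborel)"
    by (rule nn_integral_indicator[symmetric]) simp
  also have "\<dots> = (\<integral>\<^sup>+x. indicator A (F lam x) * indicator (W lam j) x \<partial>lborel)"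
    by (intro nn_integral_cong) (auto split: split_indicator)
  also have "\<dots> = ennreal (inv_slope lam j) * (\<integral>\<^sup>+y. indicator (A \<inter> {0<..lam ^ (j - 2)}) y \<partial>lborel)"
    using assms(2) by (subst nn_integral_W) (simp_all add: indicator_inter_arith[symmetric])
  finally show ?thesis by simp
qed

section \<open>Transience above one half\<close>

lemma unit_eq_UN_W: "{0<..1} = (\<Union>k. W lam (Suc k))"
  using initial_eq_UN_W[of 0] by simp

lemma W_Suc_disjoint_family: "disjoint_family (\<lambda>k. W lam (Suc k))"
  using W_disjoint_family[of 0] by simp

lemma F_measurable_leb_unit: "F lam \<in> measurable leb_unit leb_unit"
  unfolding leb_unit_def using F_unit
  by (intro measurable_restrict_space3) auto

text \<open>The first branch maps \<open>W lam 1\<close> onto the whole unit interval, so a null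
  preimage forces \<open>A\<close> to be null. Conversely, the preimage of a null set splits into
  countably many pieces, each of length a multiple of \<open>0\<close>.\<close>

lemma nonsingular_F: "nonsingular leb_unit (F lam)"
  unfolding nonsingular_def
proof (intro conjI ballI F_measurable_leb_unit)
  fix A assume "A \<in> sets leb_unit"
  then have A: "A \<subseteq> {0<..1}" and [measurable]: "A \<in> sets borel" by (auto simp: sets_leb_unit_iff)
  have [measurable]: "F lam -` A \<in> sets borel"
    using measurable_sets[of "F lam" borel borel A] by simp
  have eq: "F lam -` A \<inter> space leb_unit = (\<Union>k. F lam -` A \<inter> W lam (Suc k))"
    using unit_eq_UN_W by auto
  show "F lam -` A \<inter> space leb_unit \<in> null_sets leb_unit \<longleftrightarrow> A \<in> null_sets leb_unit"
  proof
    assume "F lam -` A \<inter> space leb_unit \<in> null_sets leb_unit"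
    then have "F lam -` A \<inter> {0<..1} \<in> null_sets lborel"
      by (simp add: null_sets_leb_unit_iff)
    then have "F lam -` A \<inter> W lam 1 \<in> null_sets lborel"
      by (rule null_sets_subset) (use W_subset_unit[of 1] in auto)
    then have "ennreal (inv_slope lam 1) * emeasure lborel (A \<inter> {0<..1}) = 0"
      using emeasure_F_vimage_W[of A 1] by (simp add: null_setsD1)
    then have "emeasure lborel A = 0"
      using inv_slope_pos[of 1] A by (simp add: Int_absorb2)
    then show "A \<in> null_sets leb_unit"
      using A by (simp add: null_sets_leb_unit_iff) (simp add: null_sets_def)
  next
    assume "A \<in> null_sets leb_unit"
    then have "emeasure lborel A = 0" by (simp add: null_sets_leb_unit_iff null_setsD1)
    then have "emeasure lborel (A \<inter> X) = 0" for X
      using emeasure_eq_0[of A lborel "A \<inter> X"] by simp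
    then have "F lam -` A \<inter> W lam (Suc k) \<in> null_sets lborel" for k
      using emeasure_F_vimage_W[of A "Suc k"] by (simp add: null_sets_def)
    then show "F lam -` A \<inter> space leb_unit \<in> null_sets leb_unit"
      unfolding null_sets_leb_unit_iff using null_sets_UN[of "\<lambda>k. F lam -` A \<inter> W lam (Suc k)"]
      by (simp add: eq[symmetric, simplified])
  qed
qed

lemma nn_integral_initial:
  assumes [measurable]: "g \<in> borel_measurable borel"
  shows "(\<integral>\<^sup>+x. g x * indicator {0<..lam ^ i} x \<partial>lborel)
    = (\<Sum>k. \<integral>\<^sup>+x. g x * indicator (W lam (i + 1 + k)) x \<partial>lborel)"
proof -
  have "(\<integral>\<^sup>+x. g x * indicator {0<..lam ^ i} x \<partial>lborel)
      = (\<integral>\<^sup>+x. (\<Sum>k. g x * indicator (W lam (i + 1 + k)) x) \<partial>lborel)"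
    unfolding ennreal_suminf_cmult suminf_indicator[OF W_disjoint_family]
      initial_eq_UN_W ..
  also have "\<dots> = (\<Sum>k. \<integral>\<^sup>+x. g x * indicator (W lam (i + 1 + k)) x \<partial>lborel)"
    by (rule nn_integral_suminf) simp
  finally show ?thesis .
qed

text \<open>
  \<open>V = r ^ W_index\<close> with \<open>r = 1 / (2 * lam)\<close> is a Lyapunov function for the transient random walk:
  its mean over a branch is at most \<open>4 * lam * (1 - lam) < 1\<close> times its value on that branch.
\<close>
lemma lyapunov_decay:
  fixes r \<rho> :: real
  assumes half: "1 / 2 < lam" and "1 \<le> j"
  defines "r \<equiv> 1 / (2 * lam)" and "\<rho> \<equiv> 4 * lam * (1 - lam)"
  shows "(\<integral>\<^sup>+x. ennreal (r ^ W_index lam ((F lam ^^ n) x)) * indicator (W lam j) x \<partial>lborel)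
    \<le> ennreal (\<rho> ^ n * (1 - lam) * r ^ j * lam ^ (j - 1))"
  using \<open>1 \<le> j\<close>
proof (induction n arbitrary: j)
  case 0
  have r: "0 < r" using lam_pos by (simp add: r_def)
  have "(\<integral>\<^sup>+x. ennreal (r ^ W_index lam ((F lam ^^ 0) x)) * indicator (W lam j) x \<partial>lborel)
      = (\<integral>\<^sup>+x. ennreal (r ^ j) * indicator (W lam j) x \<partial>lborel)"
    using W_index_eq[OF lam_pos lam_less1 0] by (intro nn_integral_cong) (auto split: split_indicator)
  also have "\<dots> = ennreal (r ^ j) * ennreal (lam ^ (j - 1) * (1 - lam))"
    using emeasure_W[OF 0] by (simp add: nn_integral_cmult)
  also have "\<dots> = ennreal (\<rho> ^ 0 * (1 - lam) * r ^ j * lam ^ (j - 1))"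
    using r lam_pos lam_less1 by (subst ennreal_mult[symmetric]) (auto simp: ac_simps)
  finally show ?case by simp
next
  case (Suc n)
  define g where "g y = ennreal (r ^ W_index lam ((F lam ^^ n) y))" for y
  have [measurable]: "g \<in> borel_measurable borel" unfolding g_def by measurable
  \<comment> \<open>The image of the branch is \<open>{0<..lam ^ i}\<close>, the union of the cells
    with index \<open>i + 1 + k\<close>; the subtraction truncates for \<open>j = 1\<close>, where
    the image is again the full interval.\<close>
  define i where "i = j - 2"
  \<comment> \<open>The inductive bound on the cell \<open>i + 1\<close>. On the cell
    \<open>i + 1 + k\<close> it becomes \<open>c * (r * lam) ^ k\<close>, and since
    \<open>r * lam = 1 / 2\<close> these bounds add up to \<open>2 * c\<close>.\<close>
  define c where "c = \<rho> ^ n * (1 - lam) * r ^ (i + 1) * lam ^ i"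
  have r: "0 < r" "r * lam = 1 / 2" using lam_pos by (simp_all add: r_def)
  have \<rho>: "0 < \<rho>" using lam_pos lam_less1 by (simp add: \<rho>_def)
  have c: "0 < c" using r \<rho> lam_pos lam_less1 by (simp add: c_def)
  have ct: "0 < inv_slope lam j" by (rule inv_slope_pos)
  have "(\<integral>\<^sup>+x. ennreal (r ^ W_index lam ((F lam ^^ Suc n) x)) * indicator (W lam j) x \<partial>lborel)
      = (\<integral>\<^sup>+x. g (F lam x) * indicator (W lam j) x \<partial>lborel)"
    by (simp add: g_def funpow_swap1)
  also have "\<dots> = ennreal (inv_slope lam j) * (\<Sum>k. \<integral>\<^sup>+x. g x * indicator (W lam (i + 1 + k)) x \<partial>lborel)"
    using Suc.prems by (simp add: nn_integral_W nn_integral_initial i_def)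
  also have "\<dots> \<le> ennreal (inv_slope lam j) * (\<Sum>k. ennreal (c * (1 / 2) ^ k))"
  proof (intro mult_left_mono suminf_le)
    fix k
    have "(\<integral>\<^sup>+x. g x * indicator (W lam (i + 1 + k)) x \<partial>lborel)
        \<le> ennreal (\<rho> ^ n * (1 - lam) * r ^ (i + 1 + k) * lam ^ (i + 1 + k - 1))"
      unfolding g_def by (rule Suc.IH) simp
    also have "\<rho> ^ n * (1 - lam) * r ^ (i + 1 + k) * lam ^ (i + 1 + k - 1) = c * (r * lam) ^ k"
      by (simp add: c_def power_add power_mult_distrib)
    finally show "(\<integral>\<^sup>+x. g x * indicator (W lam (i + 1 + k)) x \<partial>lborel) \<le> ennreal (c * (1 / 2) ^ k)"
      unfolding r(2) .
  qed auto
  also have "(\<Sum>k. ennreal (c * (1 / 2) ^ k)) = ennreal (c * 2)"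
  proof (rule suminf_ennreal_eq)
    show "(\<lambda>k. c * (1 / 2) ^ k) sums (c * 2)"
      using sums_mult[OF geometric_sums[of "1 / 2 :: real"], of c] by simp
  qed (use c in simp)
  also have "ennreal (inv_slope lam j) * ennreal (c * 2) = ennreal (inv_slope lam j * (c * 2))"
    using c ct by (simp add: ennreal_mult)
  also have "\<dots> \<le> ennreal (\<rho> ^ Suc n * (1 - lam) * r ^ j * lam ^ (j - 1))"
  proof (rule ennreal_leI)
    show "inv_slope lam j * (c * 2) \<le> \<rho> ^ Suc n * (1 - lam) * r ^ j * lam ^ (j - 1)"
    \<comment> \<open>On the first cell, where the walk cannot step down, the estimate rests on
      \<open>1 \<le> 2 * lam\<close>; on all other cells equality holds.\<close>
    proof (cases "j = 1")
      case True
      have "2 * (1 - lam) \<le> \<rho>"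
        using mult_right_mono[of 1 "2 * lam" "2 * (1 - lam)"] half lam_less1
        unfolding \<rho>_def by (simp add: algebra_simps)
      then have "2 * (1 - lam) * (\<rho> ^ n * (1 - lam) * r) \<le> \<rho> * (\<rho> ^ n * (1 - lam) * r)"
        using \<rho> r lam_less1 by (intro mult_right_mono) auto
      moreover have "inv_slope lam j * (c * 2) = 2 * (1 - lam) * (\<rho> ^ n * (1 - lam) * r)"
        using True by (simp add: inv_slope_def c_def i_def)
      moreover have "\<rho> ^ Suc n * (1 - lam) * r ^ j * lam ^ (j - 1) = \<rho> * (\<rho> ^ n * (1 - lam) * r)"
        using True by simp
      ultimately show ?thesis by (simp only:)
    next
      case False
      then have j: "j = Suc (Suc i)" using Suc.prems by (simp add: i_def)
      have "\<rho> ^ Suc n * (1 - lam) * r ^ j * lam ^ (j - 1)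
          = 4 * lam * (1 - lam) * (r * lam) * c"
        unfolding j c_def by (simp add: \<rho>_def)
      also have "\<dots> = inv_slope lam j * (c * 2)"
        unfolding r(2) using False by (simp add: inv_slope_def)
      finally show ?thesis by simp
    qed
  qed
  finally show ?case .
qed

text \<open>The geometric decay makes the integrals over a fixed cell summable in \<open>n\<close>.
  Hence the series converges almost everywhere on the cell and its terms tend to
  \<open>0\<close>.\<close>

lemma AE_lyapunov_tendsto_0:
  assumes half: "1 / 2 < lam"
  shows "AE x in leb_unit. (\<lambda>n. (1 / (2 * lam)) ^ W_index lam ((F lam ^^ n) x)) \<longlonglongrightarrow> 0"
proof -
  define r where "r = 1 / (2 * lam)"
  define \<rho> where "\<rho> = 4 * lam * (1 - lam)"
  have r: "0 < r" using lam_pos by (simp add: r_def)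
  \<comment> \<open>This square equals \<open>1 - \<rho>\<close>.\<close>
  have "0 < (2 * lam - 1) ^ 2" using half by simp
  then have \<rho>: "0 < \<rho>" "\<rho> < 1"
    using lam_pos lam_less1 by (simp_all add: \<rho>_def power2_eq_square algebra_simps)
  have "AE x in lborel. x \<in> W lam (Suc k) \<longrightarrow> (\<lambda>n. r ^ W_index lam ((F lam ^^ n) x)) \<longlonglongrightarrow> 0" for k
  proof -
    define c where "c = (1 - lam) * r ^ Suc k * lam ^ k"
    let ?f = "\<lambda>n x. ennreal (r ^ W_index lam ((F lam ^^ n) x)) * indicator (W lam (Suc k)) x"
    have "(\<integral>\<^sup>+x. (\<Sum>n. ?f n x) \<partial>lborel) = (\<Sum>n. \<integral>\<^sup>+x. ?f n x \<partial>lborel)"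
      by (rule nn_integral_suminf) simp
    also have "\<dots> \<le> (\<Sum>n. ennreal (\<rho> ^ n * c))"
      using lyapunov_decay[OF half, of "Suc k"]
      by (intro suminf_le) (auto simp: c_def r_def \<rho>_def ac_simps)
    also have "\<dots> = ennreal (1 / (1 - \<rho>) * c)"
    proof (rule suminf_ennreal_eq)
      show "(\<lambda>n. \<rho> ^ n * c) sums (1 / (1 - \<rho>) * c)"
        using \<rho> by (intro sums_mult2 geometric_sums) auto
    qed (use r \<rho> lam_pos lam_less1 in \<open>simp add: c_def\<close>)
    finally have "(\<integral>\<^sup>+x. (\<Sum>n. ?f n x) \<partial>lborel) \<noteq> \<infinity>"
      by (auto simp: top_unique)
    then have "AE x in lborel. (\<Sum>n. ?f n x) \<noteq> \<infinity>"
      by (intro nn_integral_noteq_infinite) auto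
    then show ?thesis
    proof eventually_elim
      case (elim x)
      show ?case
      proof
        assume "x \<in> W lam (Suc k)"
        with elim have "(\<Sum>n. ennreal (r ^ W_index lam ((F lam ^^ n) x))) \<noteq> top" by simp
        then have "summable (\<lambda>n. r ^ W_index lam ((F lam ^^ n) x))"
          using r by (intro summable_suminf_not_top) auto
        then show "(\<lambda>n. r ^ W_index lam ((F lam ^^ n) x)) \<longlonglongrightarrow> 0"
          by (rule summable_LIMSEQ_zero)
      qed
    qed
  qed
  then have "AE x in lborel. \<forall>k. x \<in> W lam (Suc k) \<longrightarrow> (\<lambda>n. r ^ W_index lam ((F lam ^^ n) x)) \<longlonglongrightarrow> 0"
    by (subst AE_all_countable) auto
  then have "AE x in lborel. x \<in> {0<..1} \<longrightarrow> (\<lambda>n. r ^ W_index lam ((F lam ^^ n) x)) \<longlonglongrightarrow> 0"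
    by eventually_elim (unfold unit_eq_UN_W, blast)
  then show ?thesis
    unfolding leb_unit_def by (subst AE_restrict_space_iff) (auto simp: r_def)
qed

text \<open>Along almost every orbit the Lyapunov function finally stays below its value on the
  starting cell, so that cell is visited only finitely often.\<close>

lemma dissipative_F:
  assumes half: "1 / 2 < lam"
  shows "dissipative leb_unit (F lam)"
proof (rule dissipativeI_finite_visits[OF nonsingular_F])
  show "range (\<lambda>k. W lam (Suc k)) \<subseteq> sets leb_unit"
    using W_subset_unit by (auto simp: sets_leb_unit_iff)
  show "AE x in leb_unit. \<exists>B\<in>range (\<lambda>k. W lam (Suc k)). x \<in> B \<and> finite {n. (F lam ^^ n) x \<in> B}"
    using AE_lyapunov_tendsto_0[OF half] AE_space
  proof eventually_elim
    case (elim x)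
    from elim(2) have "x \<in> (\<Union>k. W lam (Suc k))" unfolding space_leb_unit unit_eq_UN_W .
    then obtain k where k: "x \<in> W lam (Suc k)" by blast
    have "\<forall>\<^sub>F n in sequentially. (1 / (2 * lam)) ^ W_index lam ((F lam ^^ n) x) < (1 / (2 * lam)) ^ Suc k"
      using elim(1) lam_pos by (intro order_tendstoD) auto
    then obtain N where N: "\<And>n. N \<le> n \<Longrightarrow> (1 / (2 * lam)) ^ W_index lam ((F lam ^^ n) x) < (1 / (2 * lam)) ^ Suc k"
      by (auto simp: eventually_sequentially)
    have "{n. (F lam ^^ n) x \<in> W lam (Suc k)} \<subseteq> {..<N}"
    proof
      fix n assume "n \<in> {n. (F lam ^^ n) x \<in> W lam (Suc k)}"
      then have "W_index lam ((F lam ^^ n) x) = Suc k"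
        by (intro W_index_eq[OF lam_pos lam_less1]) auto
      then show "n \<in> {..<N}" using N[of n] by (cases "N \<le> n") auto
    qed
    then have "finite {n. (F lam ^^ n) x \<in> W lam (Suc k)}"
      by (rule finite_subset) simp
    then show ?case using k by blast
  qed
qed simp

section \<open>Rigidity of invariant densities\<close>

lemma integral_initial_eq_0:
  fixes f :: "real \<Rightarrow> real"
  assumes [measurable]: "f \<in> borel_measurable borel" and f: "\<And>x. \<bar>f x\<bar> \<le> 1"
    and 0: "\<And>k. 1 \<le> k \<Longrightarrow> (\<integral>x. f x * indicator (W lam k) x \<partial>lborel) = 0"
  shows "(\<integral>x. f x * indicator {0<..lam ^ i} x \<partial>lborel) = 0"
proof -
  have "lam ^ i \<le> 1" using lam_pos lam_less1 by (simp add: power_le_one)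
  then have "integrable lborel (\<lambda>x. f x * indicator {0<..lam ^ i} x)"
    using f by (intro integrable_bounded_unit) auto
  then have "set_integrable lborel (\<Union>k. W lam (i + 1 + k)) f"
    unfolding initial_eq_UN_W[symmetric] set_integrable_def
    by (simp add: mult.commute)
  then have "(LINT x:(\<Union>k. W lam (i + 1 + k))|lborel. f x) = (\<Sum>k. LINT x:W lam (i + 1 + k)|lborel. f x)"
    by (intro lebesgue_integral_countable_add W_disjoint) auto
  also have "\<dots> = 0"
    using 0 by (simp add: set_lebesgue_integral_def mult.commute)
  finally show ?thesis
    unfolding initial_eq_UN_W[symmetric] set_lebesgue_integral_def
    by (simp add: mult.commute)
qed

section \<open>Decay of functions with mean zero on every cell\<close>

context
  fixes \<phi> :: "real \<Rightarrow> real"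
  assumes \<phi>_meas [measurable]: "\<phi> \<in> borel_measurable borel" and \<phi>_bound: "\<And>x. \<bar>\<phi> x\<bar> \<le> 1"
    and \<phi>_mean_0: "\<And>k. 1 \<le> k \<Longrightarrow> (\<integral>x. \<phi> x * indicator (W lam k) x \<partial>lborel) = 0"
begin

text \<open>The Markov property: a branch sends its cell affinely onto a union of cells, so mean
  zero on all cells passes from one iterate to the next.\<close>

lemma integral_W_F_pow_eq_0:
  "1 \<le> k \<Longrightarrow> (\<integral>x. \<phi> ((F lam ^^ n) x) * indicator (W lam k) x \<partial>lborel) = 0"
proof (induction n arbitrary: k)
  case 0
  then show ?case using \<phi>_mean_0 by simp
next
  case (Suc n)
  have "(\<integral>x. \<phi> ((F lam ^^ Suc n) x) * indicator (W lam k) x \<partial>lborel)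
      = (\<integral>x. (\<lambda>y. \<phi> ((F lam ^^ n) y)) (F lam x) * indicator (W lam k) x \<partial>lborel)"
    by (simp add: funpow_swap1)
  also have "\<dots> = inv_slope lam k * (\<integral>y. \<phi> ((F lam ^^ n) y) * indicator {0<..lam ^ (k - 2)} y \<partial>lborel)"
    by (rule integral_W[OF Suc.prems])
  also have "(\<integral>y. \<phi> ((F lam ^^ n) y) * indicator {0<..lam ^ (k - 2)} y \<partial>lborel) = 0"
    using Suc.IH \<phi>_bound by (intro integral_initial_eq_0) auto
  finally show ?case by simp
qed

text \<open>The primitive of the next iterate at \<open>a\<close> is \<open>inv_slope lam j\<close>
  times the primitive of the current one at \<open>F lam a\<close>, and
  \<open>inv_slope lam j \<le> 1 - lam\<close>.\<close>

lemma abs_integral_F_pow_le: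
  assumes "a \<in> {0<..1}"
  shows "\<bar>\<integral>x. \<phi> ((F lam ^^ n) x) * indicator {0<..a} x \<partial>lborel\<bar> \<le> (1 - lam) ^ n"
  using assms
proof (induction n arbitrary: a)
  case 0
  have "\<bar>\<integral>x. \<phi> x * indicator {0<..a} x \<partial>lborel\<bar> \<le> (\<integral>x. \<bar>\<phi> x * indicator {0<..a} x\<bar> \<partial>lborel)"
    by (rule integral_abs_bound)
  also have "\<dots> \<le> (\<integral>x. indicator {0<..1::real} x \<partial>lborel)"
  proof (rule Bochner_Integration.integral_mono)
    show "integrable lborel (\<lambda>x. \<bar>\<phi> x * indicator {0<..a} x\<bar>)"
      using 0 \<phi>_bound by (intro integrable_abs integrable_bounded_unit) auto
    show "\<bar>\<phi> x * indicator {0<..a} x\<bar> \<le> indicator {0<..1} x" for x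
      using 0 \<phi>_bound[of x] by (auto split: split_indicator)
  qed simp
  finally show ?case by simp
next
  case (Suc n)
  define j where "j = W_index lam a"
  note j = W_index_W[OF Suc.prems, folded j_def]
  define g where "g x = \<phi> ((F lam ^^ n) x)" for x
  have [measurable]: "g \<in> borel_measurable borel" unfolding g_def by measurable
  have g: "\<bar>g x\<bar> \<le> 1" for x using \<phi>_bound by (simp add: g_def)
  have lj: "0 < lam ^ j" "lam ^ j < a" using j lam_pos by (auto simp: W_def)
  have gF: "\<phi> ((F lam ^^ Suc n) x) = g (F lam x)" for x
    by (simp add: g_def funpow_swap1)
  have "(\<integral>x. g (F lam x) * indicator {0<..a} x \<partial>lborel)
      = (\<integral>x. g (F lam x) * indicator {0<..lam ^ j} x + g (F lam x) * indicator {lam ^ j<..a} x \<partial>lborel)"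
    using lj by (intro Bochner_Integration.integral_cong) (auto split: split_indicator)
  also have "\<dots> = (\<integral>x. g (F lam x) * indicator {0<..lam ^ j} x \<partial>lborel)
      + (\<integral>x. g (F lam x) * indicator {lam ^ j<..a} x \<partial>lborel)"
    using lj Suc.prems g by (intro Bochner_Integration.integral_add integrable_bounded_unit) auto
  \<comment> \<open>The complete cells below \<open>a\<close> contribute nothing; only the cut
    branch containing \<open>a\<close> remains.\<close>
  also have "(\<integral>x. g (F lam x) * indicator {0<..lam ^ j} x \<partial>lborel) = 0"
    using integral_W_F_pow_eq_0[of _ "Suc n"] g unfolding gF by (intro integral_initial_eq_0) auto
  also have "(\<integral>x. g (F lam x) * indicator {lam ^ j<..a} x \<partial>lborel)
      = inv_slope lam j * (\<integral>y. g y * indicator {0<..F lam a} y \<partial>lborel)"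
    by (rule integral_branch[OF j])
  finally have "\<bar>\<integral>x. g (F lam x) * indicator {0<..a} x \<partial>lborel\<bar>
      = inv_slope lam j * \<bar>\<integral>y. g y * indicator {0<..F lam a} y \<partial>lborel\<bar>"
    using inv_slope_pos[of j] by (simp add: abs_mult)
  also have "\<dots> \<le> (1 - lam) * (1 - lam) ^ n"
    using Suc.IH[OF F_unit[OF Suc.prems]] inv_slope_pos[of j]
      inv_slope_le[of j]
    unfolding g_def by (intro mult_mono) auto
  finally show ?case unfolding gF by simp
qed

text \<open>The estimate of the primitives settles the intervals starting at \<open>0\<close>, and
  \<open>weak_null_L1\<close> extends the limit to every integrable \<open>h\<close>.\<close>

lemma integral_density_F_pow_tendsto_0:
  assumes h: "integrable leb_unit h"
  shows "(\<lambda>n. \<integral>x. h x * \<phi> ((F lam ^^ n) x) \<partial>leb_unit) \<longlonglongrightarrow> 0"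
proof -
  have fin: "finite_measure leb_unit"
    by (rule finite_measureI) (simp add: emeasure_leb_unit)
  have lim: "(\<lambda>n. \<integral>x. \<phi> ((F lam ^^ n) x) * indicator {0<..a} x \<partial>lborel) \<longlonglongrightarrow> 0" if "a \<in> {0<..1}" for a
  proof (rule Lim_null_comparison)
    show "(\<lambda>n. (1 - lam) ^ n) \<longlonglongrightarrow> 0"
      using lam_pos lam_less1 by (intro LIMSEQ_realpow_zero) auto
    show "\<forall>\<^sub>F n in sequentially.
        norm (\<integral>x. \<phi> ((F lam ^^ n) x) * indicator {0<..a} x \<partial>lborel) \<le> (1 - lam) ^ n"
      using abs_integral_F_pow_le[OF that] by simp
  qed
  have restr: "(\<integral>x. f x \<partial>leb_unit) = (\<integral>x. f x * indicator {0<..1} x \<partial>lborel)" for f :: "real \<Rightarrow> real"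
    by (simp add: leb_unit_def integral_restrict_space mult.commute)
  show ?thesis
  proof (rule weak_null_L1[OF fin sets_leb_unit_generator])
    show "Int_stable ((\<inter>) {0<..1} ` range atMost :: real set set)"
    proof (rule Int_stableI_image)
      fix A B :: "real set" assume "A \<in> range atMost" "B \<in> range atMost"
      then obtain a b where "A = {..a}" "B = {..b}" by auto
      then have "({0<..1} \<inter> A) \<inter> ({0<..1} \<inter> B) = {0<..1} \<inter> {..min a b}" by auto
      then show "\<exists>C\<in>range atMost. ({0<..1} \<inter> A) \<inter> ({0<..1} \<inter> B) = {0<..1} \<inter> C" by blast
    qed
    show "(\<lambda>x. \<phi> ((F lam ^^ n) x)) \<in> borel_measurable leb_unit" for n
      by (rule measurable_leb_unit) measurable
    show "(\<lambda>n. \<integral>x. indicator A x * \<phi> ((F lam ^^ n) x) \<partial>leb_unit) \<longlonglongrightarrow> 0"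
      if A_in: "A \<in> (\<inter>) {0<..1} ` range atMost" for A
    proof -
      obtain a where A: "A = {0<..1} \<inter> {..a}" using A_in by auto
      have "(\<integral>x. indicator A x * \<phi> ((F lam ^^ n) x) \<partial>leb_unit)
          = (\<integral>x. \<phi> ((F lam ^^ n) x) * indicator {0<..min a 1} x \<partial>lborel)" for n
        unfolding restr by (intro Bochner_Integration.integral_cong) (auto simp: A split: split_indicator)
      moreover have "(\<lambda>n. \<integral>x. \<phi> ((F lam ^^ n) x) * indicator {0<..min a 1} x \<partial>lborel) \<longlonglongrightarrow> 0"
        by (cases "0 < a") (use lim[of "min a 1"] in auto)
      ultimately show ?thesis by simp
    qed
    show "(\<lambda>n. \<integral>x. \<phi> ((F lam ^^ n) x) \<partial>leb_unit) \<longlonglongrightarrow> 0"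
      unfolding restr using lim[of 1] by simp
  qed (use \<phi>_bound h in auto)
qed

text \<open>By invariance the integral of \<open>\<phi> \<circ> F^n\<close> is the same for all
  \<open>n\<close>; written with the density of \<open>\<mu>\<close> it tends to
  \<open>0\<close>.\<close>

lemma integral_acip_eq_0:
  assumes \<mu>: "acip leb_unit (F lam) \<mu>"
  shows "(\<integral>x. \<phi> x \<partial>\<mu>) = 0"
proof -
  interpret prob_space \<mu> using \<mu> by (simp add: acip_def)
  have sets: "sets \<mu> = sets leb_unit" and ac: "absolutely_continuous leb_unit \<mu>"
    and F: "F lam \<in> measurable \<mu> \<mu>" and inv: "distr \<mu> \<mu> (F lam) = \<mu>"
    using \<mu> by (auto simp: acip_def invariant_measure_def)
  have meas: "f \<in> borel_measurable borel \<Longrightarrow> f \<in> borel_measurable \<mu>" for f :: "real \<Rightarrow> real"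
    using measurable_leb_unit measurable_cong_sets[OF sets refl] by blast
  have step: "(\<integral>x. f (F lam x) \<partial>\<mu>) = (\<integral>x. f x \<partial>\<mu>)" if "f \<in> borel_measurable borel" for f :: "real \<Rightarrow> real"
    using integral_distr[OF F meas[OF that]] by (simp add: inv)
  have pow: "(\<integral>x. \<phi> ((F lam ^^ n) x) \<partial>\<mu>) = (\<integral>x. \<phi> x \<partial>\<mu>)" for n
  proof (induction n)
    case (Suc n)
    have "(\<integral>x. \<phi> ((F lam ^^ Suc n) x) \<partial>\<mu>) = (\<integral>x. \<phi> ((F lam ^^ n) (F lam x)) \<partial>\<mu>)"
      by (simp add: funpow_swap1)
    also have "\<dots> = (\<integral>x. \<phi> ((F lam ^^ n) x) \<partial>\<mu>)" by (rule step) measurable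
    finally show ?case using Suc by simp
  qed simp
  interpret L: finite_measure leb_unit
    by (rule finite_measureI) (simp add: emeasure_leb_unit)
  obtain h where h [measurable]: "h \<in> borel_measurable leb_unit" and
    RN: "AE x in leb_unit. RN_deriv leb_unit \<mu> x = ennreal (h x)" and h0: "\<And>x. 0 \<le> h x"
    using L.real_RN_deriv[OF finite_measure_axioms ac sets] by blast
  have "density leb_unit (\<lambda>x. ennreal (h x)) = density leb_unit (RN_deriv leb_unit \<mu>)"
    using RN by (intro density_cong) auto
  then have dens: "density leb_unit (\<lambda>x. ennreal (h x)) = \<mu>"
    using L.density_RN_deriv[OF ac sets] by simp
  have "(\<integral>\<^sup>+x. ennreal (h x) \<partial>leb_unit) = emeasure \<mu> (space leb_unit)"
    unfolding dens[symmetric] by (subst emeasure_density) (auto intro!: nn_integral_cong simp: sets_leb_unit_iff)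
  also have "\<dots> = 1"
    using emeasure_space_1 sets_eq_imp_space_eq[OF sets] by simp
  finally have "integrable leb_unit h"
    using h0 by (intro integrableI_nonneg) auto
  from integral_density_F_pow_tendsto_0[OF this]
  have "(\<lambda>n. \<integral>x. \<phi> ((F lam ^^ n) x) \<partial>\<mu>) \<longlonglongrightarrow> 0"
    unfolding dens[symmetric] using h0
    by (subst integral_density) (auto intro!: measurable_leb_unit)
  then show ?thesis unfolding pow by (simp add: LIMSEQ_const_iff)
qed

end

text \<open>This is the constancy of the invariant density on each cell, in a form without
  quotients.\<close>

lemma acip_proportional_on_W:
  assumes \<mu>: "acip leb_unit (F lam) \<mu>" and k: "1 \<le> k"
    and [measurable]: "A \<in> sets borel" and A: "A \<subseteq> W lam k"
  shows "measure \<mu> A * measure lborel (W lam k) = measure \<mu> (W lam k) * measure lborel A"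
proof -
  interpret prob_space \<mu> using \<mu> by (simp add: acip_def)
  have sets: "sets \<mu> = sets leb_unit" using \<mu> by (simp add: acip_def)
  have Wk: "W lam k \<subseteq> {0<..1}" by (rule W_subset_unit[OF k])
  then have [measurable]: "W lam k \<in> sets \<mu>" "A \<in> sets \<mu>"
    using A by (auto simp: sets sets_leb_unit_iff)
  have fin: "emeasure lborel (W lam k) < \<infinity>" "emeasure lborel A < \<infinity>"
    using emeasure_W[OF k] emeasure_mono[OF A, of lborel]
    by (auto simp: less_top[symmetric] top_unique)
  define w a where "w = measure lborel (W lam k)" and "a = measure lborel A"
  have "a \<le> w" unfolding a_def w_def using A fin by (intro measure_mono_fmeasurable fmeasurableI) auto
  moreover have "w \<le> 1" "0 \<le> a"
    using measure_W[OF k] lam_pos lam_less1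
    by (auto simp: w_def a_def intro!: mult_le_one power_le_one)
  ultimately have wa: "0 \<le> a" "a \<le> 1" "0 \<le> w" "w \<le> 1" by auto
  \<comment> \<open>The weights give \<open>\<phi>\<close> Lebesgue mean zero on
    \<open>W lam k\<close>, and \<open>0 \<le> a \<le> w \<le> 1\<close> bounds it by one.\<close>
  define \<phi> where "\<phi> x = indicator A x * w - indicator (W lam k) x * a" for x
  have "(\<integral>x. \<phi> x \<partial>\<mu>) = 0"
  proof (rule integral_acip_eq_0[OF _ _ _ \<mu>])
    show "\<phi> \<in> borel_measurable borel" unfolding \<phi>_def by measurable
    show "\<bar>\<phi> x\<bar> \<le> 1" for x
      using wa A by (auto simp: \<phi>_def split: split_indicator)
    show "(\<integral>x. \<phi> x * indicator (W lam i) x \<partial>lborel) = 0" if i: "1 \<le> i" for i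
    proof (cases "i = k")
      case True
      have "(\<integral>x. \<phi> x * indicator (W lam i) x \<partial>lborel)
          = (\<integral>x. indicator A x * w - indicator (W lam k) x * a \<partial>lborel)"
        using A True by (intro Bochner_Integration.integral_cong) (auto simp: \<phi>_def split: split_indicator)
      also have "\<dots> = a * w - w * a"
        unfolding w_def a_def using fin by (subst Bochner_Integration.integral_diff) auto
      finally show ?thesis by simp
    next
      case False
      then have "\<phi> x * indicator (W lam i) x = 0" for x
        using A W_disjoint[OF i k] by (auto simp: \<phi>_def split: split_indicator)
      then show ?thesis by (simp only: Bochner_Integration.integral_zero)
    qed
  qed
  moreover have "(\<integral>x. \<phi> x \<partial>\<mu>) = measure \<mu> A * w - measure \<mu> (W lam k) * a"
    unfolding \<phi>_def by (subst Bochner_Integration.integral_diff) (auto simp: emeasure_eq_measure)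
  ultimately show ?thesis by (simp add: w_def a_def)
qed

lemma measure_W_pos: "1 \<le> k \<Longrightarrow> 0 < measure lborel (W lam k)"
  using measure_W[of k] lam_pos lam_less1 by simp

text \<open>Here \<open>h n\<close> is the constant value of the density on the \<open>n\<close>-th
  cell. The preimage of \<open>W lam k\<close> meets only the cells up to \<open>k + 1\<close>, and
  proportionality turns the length of each piece into its mass.\<close>

lemma acip_stationary:
  assumes \<mu>: "acip leb_unit (F lam) \<mu>" and k: "1 \<le> k"
  defines "h \<equiv> \<lambda>n. measure \<mu> (W lam n) / measure lborel (W lam n)"
  shows "h k = (\<Sum>n=1..Suc k. inv_slope lam n * h n)"
proof -
  interpret prob_space \<mu> using \<mu> by (simp add: acip_def)
  have sets: "sets \<mu> = sets leb_unit" using \<mu> by (simp add: acip_def)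
  have space: "space \<mu> = {0<..1}" using sets_eq_imp_space_eq[OF sets] by simp
  have F: "F lam \<in> measurable \<mu> \<mu>" and inv: "distr \<mu> \<mu> (F lam) = \<mu>"
    using \<mu> by (auto simp: acip_def invariant_measure_def)
  have Wsets: "W lam n \<in> sets \<mu>" if "1 \<le> n" for n
    using W_subset_unit[OF that] by (simp add: sets sets_leb_unit_iff)
  have [measurable]: "F lam -` W lam k \<in> sets borel"
    using measurable_sets[of "F lam" borel borel "W lam k"] by simp
  have part: "F lam -` W lam k \<inter> {0<..1} = (\<Union>n\<in>{1..Suc k}. F lam -` W lam k \<inter> W lam n)"
  proof (intro subset_antisym subsetI)
    fix x assume x: "x \<in> F lam -` W lam k \<inter> {0<..1}"
    define n where "n = W_index lam x"
    have n: "1 \<le> n" "x \<in> W lam n" using W_index_W[of x] x by (auto simp: n_def)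
    from F_W_bounds[OF n] x have "lam ^ k < lam ^ (n - 2)" by (auto simp: W_def)
    then have "n - 2 < k" using lam_pos lam_less1 by (simp add: power_strict_decreasing_iff)
    then show "x \<in> (\<Union>n\<in>{1..Suc k}. F lam -` W lam k \<inter> W lam n)"
      using n x by (intro UN_I[of n]) auto
  next
    fix x assume "x \<in> (\<Union>n\<in>{1..Suc k}. F lam -` W lam k \<inter> W lam n)"
    then obtain n where "1 \<le> n" "x \<in> W lam n" "x \<in> F lam -` W lam k" by auto
    then show "x \<in> F lam -` W lam k \<inter> {0<..1}" using W_subset_unit by blast
  qed
  have piece: "measure \<mu> (F lam -` W lam k \<inter> W lam n) = inv_slope lam n * h n * measure lborel (W lam k)"
    if n: "n \<in> {1..Suc k}" for n
  proof -
    have "n - 2 < k" using n k by auto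
    \<comment> \<open>The image of the \<open>n\<close>-th cell covers all of
      \<open>W lam k\<close>, so the full length is pulled back.\<close>
    then have "W lam k \<inter> {0<..lam ^ (n - 2)} = W lam k"
      using W_subset_initial[OF \<open>n - 2 < k\<close>] by blast
    then have "measure lborel (F lam -` W lam k \<inter> W lam n) = inv_slope lam n * measure lborel (W lam k)"
      using emeasure_F_vimage_W[of "W lam k" n] n inv_slope_pos[of n]
      by (simp add: measure_def enn2real_mult)
    then have "measure \<mu> (F lam -` W lam k \<inter> W lam n) * measure lborel (W lam n)
        = measure \<mu> (W lam n) * (inv_slope lam n * measure lborel (W lam k))"
      using acip_proportional_on_W[OF \<mu>, of n "F lam -` W lam k \<inter> W lam n"] n by simp
    then show ?thesis
      using measure_W_pos[of n] n by (simp add: h_def field_simps)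
  qed
  have "measure \<mu> (W lam k) = measure \<mu> (F lam -` W lam k \<inter> {0<..1})"
    using measure_distr[OF F Wsets[OF k]] by (simp add: inv space)
  also have "\<dots> = (\<Sum>n=1..Suc k. measure \<mu> (F lam -` W lam k \<inter> W lam n))"
    unfolding part
  proof (rule measure_finite_Union)
    show "(\<lambda>n. F lam -` W lam k \<inter> W lam n) ` {1..Suc k} \<subseteq> sets \<mu>"
    proof (intro image_subsetI)
      fix n assume "n \<in> {1..Suc k}"
      then have "F lam -` W lam k \<inter> W lam n \<subseteq> {0<..1}"
        using W_subset_unit[of n] by auto
      then show "F lam -` W lam k \<inter> W lam n \<in> sets \<mu>" by (simp add: sets sets_leb_unit_iff)
    qed
    show "disjoint_family_on (\<lambda>n. F lam -` W lam k \<inter> W lam n) {1..Suc k}"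
      unfolding disjoint_family_on_def
    proof (intro ballI impI)
      fix i j assume "i \<in> {1..Suc k}" "j \<in> {1..Suc k}" "i \<noteq> j"
      then have "W lam i \<inter> W lam j = {}" by (intro W_disjoint) auto
      then show "F lam -` W lam k \<inter> W lam i \<inter> (F lam -` W lam k \<inter> W lam j) = {}" by blast
    qed
  qed (auto simp: emeasure_eq_measure)
  also have "\<dots> = (\<Sum>n=1..Suc k. inv_slope lam n * h n) * measure lborel (W lam k)"
    unfolding sum_distrib_right using piece by (intro sum.cong refl)
  finally show ?thesis using measure_W_pos[OF k] by (simp add: h_def field_simps)
qed

text \<open>The recurrence makes the cell masses a geometric sequence of ratio
  \<open>q = lam / (1 - lam)\<close>. Total mass one forces \<open>q < 1\<close>, that is
  \<open>lam < 1 / 2\<close>, and first term \<open>1 - q\<close>.\<close>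

lemma acip_measure_W:
  assumes \<mu>: "acip leb_unit (F lam) \<mu>"
  shows "lam < 1 / 2"
    and "1 \<le> i \<Longrightarrow> measure \<mu> (W lam i) = (1 - 2 * lam) / lam * (lam / (1 - lam)) ^ i"
proof -
  interpret prob_space \<mu> using \<mu> by (simp add: acip_def)
  have sets: "sets \<mu> = sets leb_unit" using \<mu> by (simp add: acip_def)
  have space: "space \<mu> = {0<..1}" using sets_eq_imp_space_eq[OF sets] by simp
  define c where "c = measure \<mu> (W lam 1)"
  define q where "q = lam / (1 - lam)"
  have q: "0 < q" using lam_pos lam_less1 by (simp add: q_def)
  have W_c: "measure \<mu> (W lam (Suc k)) = c * q ^ k" for k
  proof -
    have "measure \<mu> (W lam (Suc k)) / measure lborel (W lam (Suc k))
        = measure \<mu> (W lam 1) / measure lborel (W lam 1) / (1 - lam) ^ k"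
      using acip_stationary[OF \<mu>] by (rule stationary_recurrence[OF lam_pos lam_less1])
    then have "measure \<mu> (W lam (Suc k)) / (lam ^ k * (1 - lam)) = c / (1 - lam) / (1 - lam) ^ k"
      using measure_W[of 1] measure_W[of "Suc k"]
      by (simp add: c_def)
    then have "measure \<mu> (W lam (Suc k)) = c / (1 - lam) / (1 - lam) ^ k * (lam ^ k * (1 - lam))"
      using lam_pos lam_less1 by (simp add: nonzero_divide_eq_eq)
    then show ?thesis using lam_less1 by (simp add: q_def power_divide)
  qed
  have "(\<lambda>k. measure \<mu> (W lam (Suc k))) sums measure \<mu> (\<Union>k. W lam (Suc k))"
    using W_subset_unit W_Suc_disjoint_family
    by (intro finite_measure_UNION) (auto simp: sets sets_leb_unit_iff)
  then have s: "(\<lambda>k. c * q ^ k) sums 1"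
    using prob_space unfolding W_c unit_eq_UN_W[symmetric] by (simp add: space)
  have "c \<noteq> 0"
  proof
    assume "c = 0"
    with s have "(\<lambda>k. 0 :: real) sums 1" by simp
    from sums_unique2[OF this sums_zero] show False by simp
  qed
  then have "summable (\<lambda>k. q ^ k)" using sums_summable[OF s] by simp
  then have q1: "q < 1" using q by (simp add: summable_geometric_iff)
  then show half: "lam < 1 / 2" using lam_less1 by (simp add: q_def field_simps)
  have "(\<lambda>k. c * q ^ k) sums (c * (1 / (1 - q)))"
    using q q1 by (intro sums_mult geometric_sums) simp
  then have "c * (1 / (1 - q)) = 1" using s sums_unique2 by blast
  then have "c = 1 - q" using q1 by (simp add: field_simps)
  \<comment> \<open>Splitting off one factor \<open>q\<close> turns the exponent
    \<open>i - 1\<close> into \<open>i\<close>.\<close>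
  also have "\<dots> = (1 - 2 * lam) / lam * q" using lam_pos lam_less1 by (simp add: q_def field_simps)
  finally have c: "c = (1 - 2 * lam) / lam * q" .
  show "measure \<mu> (W lam i) = (1 - 2 * lam) / lam * (lam / (1 - lam)) ^ i" if "1 \<le> i"
    using W_c[of "i - 1"] that by (cases i) (simp_all add: c q_def)
qed

section \<open>The invariant density below one half\<close>

text \<open>The solution of \<open>stationary_recurrence\<close>, normalised so that the first cell,
  of length \<open>1 - lam\<close>, has mass \<open>1 - q\<close> with
  \<open>q = lam / (1 - lam)\<close>.\<close>

definition acip_density :: "nat \<Rightarrow> real" where
  "acip_density i = (1 - 2 * lam) / (1 - lam) ^ (i + 1)"

text \<open>The fixed point equation of the transfer operator on the \<open>k\<close>-th cell, which
  receives mass from the cells \<open>1\<close> to \<open>k + 1\<close>. The difference of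
  consecutive densities is exactly the summand added.\<close>

lemma sum_acip_density:
  assumes "1 \<le> k"
  shows "(\<Sum>n\<le>k. acip_density (Suc n) * inv_slope lam (Suc n)) = acip_density k"
proof -
  \<comment> \<open>With \<open>p\<close> and \<open>c\<close> as atoms, powers of
    \<open>1 - lam\<close> cancel without being expanded.\<close>
  define p c where "p = 1 - lam" and "c = 1 - 2 * lam"
  have p: "p \<noteq> 0" using lam_less1 by (simp add: p_def)
  have dens: "acip_density i = c / p ^ (i + 1)" for i by (simp add: acip_density_def p_def c_def)
  have inv_slope: "inv_slope lam i = (if i = 1 then p else (1 - p) * p)" for i by (simp add: inv_slope_def p_def)
  show ?thesis
    using assms
  proof (induction k rule: nat_induct_at_least)
    case base
    show ?case using p by (simp add: dens inv_slope field_simps power2_eq_square)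
  next
    case (Suc k)
    then show ?case using p by (simp add: dens inv_slope field_simps)
  qed
qed

context
  assumes half: "lam < 1 / 2"
begin

lemma acip_density_nonneg: "0 \<le> acip_density i"
  using half lam_less1 by (simp add: acip_density_def)

definition acip_measure :: "real measure" where
  "acip_measure = density leb_unit (\<lambda>x. ennreal (acip_density (W_index lam x)))"

lemma nn_integral_leb_unit:
  assumes "f \<in> borel_measurable borel"
  shows "(\<integral>\<^sup>+x. f x \<partial>leb_unit) = (\<Sum>k. \<integral>\<^sup>+x. f x * indicator (W lam (Suc k)) x \<partial>lborel)"
  using nn_integral_initial[OF assms, of 0]
  by (simp add: leb_unit_def nn_integral_restrict_space)

lemma emeasure_acip_measure_nn:
  assumes A: "A \<in> sets leb_unit"
  shows "emeasure acip_measure A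
    = (\<integral>\<^sup>+x. ennreal (acip_density (W_index lam x)) * indicator A x \<partial>lborel)"
proof -
  have "emeasure acip_measure A
      = (\<integral>\<^sup>+x. ennreal (acip_density (W_index lam x)) * indicator A x \<partial>leb_unit)"
    unfolding acip_measure_def
    by (intro emeasure_density A measurable_leb_unit) measurable
  also have "\<dots> = (\<integral>\<^sup>+x. ennreal (acip_density (W_index lam x)) * indicator A x \<partial>lborel)"
    using A by (auto simp: leb_unit_def nn_integral_restrict_space sets_restrict_space_iff
        intro!: nn_integral_cong split: split_indicator)
  finally show ?thesis .
qed

lemma emeasure_acip_measure:
  assumes A: "A \<in> sets leb_unit"
  shows "emeasure acip_measure A
    = (\<Sum>k. ennreal (acip_density (Suc k)) * emeasure lborel (A \<inter> W lam (Suc k)))"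
proof -
  have [measurable]: "A \<in> sets borel" using A by (simp add: sets_leb_unit_iff)
  have "emeasure acip_measure A
      = (\<integral>\<^sup>+x. ennreal (acip_density (W_index lam x)) * indicator A x \<partial>leb_unit)"
    unfolding acip_measure_def
    by (intro emeasure_density A measurable_leb_unit) measurable
  also have "\<dots> = (\<Sum>k. \<integral>\<^sup>+x. ennreal (acip_density (W_index lam x)) * indicator A x
      * indicator (W lam (Suc k)) x \<partial>lborel)"
    by (rule nn_integral_leb_unit) measurable
  also have "\<dots> = (\<Sum>k. \<integral>\<^sup>+x. ennreal (acip_density (Suc k)) * indicator (A \<inter> W lam (Suc k)) x \<partial>lborel)"
  proof (intro suminf_cong nn_integral_cong)
    fix k x
    show "ennreal (acip_density (W_index lam x)) * indicator A x * indicator (W lam (Suc k)) x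
        = ennreal (acip_density (Suc k)) * indicator (A \<inter> W lam (Suc k)) x"
      using W_index_eq[OF lam_pos lam_less1, of "Suc k" x]
      by (cases "x \<in> W lam (Suc k)") (auto split: split_indicator)
  qed
  also have "\<dots> = (\<Sum>k. ennreal (acip_density (Suc k)) * emeasure lborel (A \<inter> W lam (Suc k)))"
    by (intro suminf_cong nn_integral_cmult_indicator) measurable
  finally show ?thesis .
qed

text \<open>Density times cell length gives the masses \<open>(1 - q) * q ^ k\<close>, a geometric
  series with sum one.\<close>

lemma prob_space_acip_measure: "prob_space acip_measure"
proof
  define q where "q = lam / (1 - lam)"
  have q: "0 < q" "q < 1" using lam_pos half by (simp_all add: q_def)
  have q1: "1 - q = (1 - 2 * lam) / (1 - lam)" using lam_less1 by (simp add: q_def field_simps)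
  have cancel: "c / p ^ (k + 2) * (l ^ k * p) = c / p * (l / p) ^ k" if "p \<noteq> 0" for c l p :: real and k
    using that by (simp add: power_divide field_simps)
  have "emeasure acip_measure {0<..1} = (\<Sum>k. ennreal ((1 - q) * q ^ k))"
  proof (subst emeasure_acip_measure)
    show "(\<Sum>k. ennreal (acip_density (Suc k)) * emeasure lborel ({0<..1} \<inter> W lam (Suc k)))
        = (\<Sum>k. ennreal ((1 - q) * q ^ k))"
    proof (rule suminf_cong)
      fix k
      have "{0<..1} \<inter> W lam (Suc k) = W lam (Suc k)"
        using W_subset_unit[of "Suc k"] by auto
      moreover have "acip_density (Suc k) * (lam ^ k * (1 - lam)) = (1 - q) * q ^ k"
        using cancel[of "1 - lam" "1 - 2 * lam" k lam] lam_less1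
        unfolding q1 unfolding q_def by (simp add: acip_density_def)
      ultimately show "ennreal (acip_density (Suc k)) * emeasure lborel ({0<..1} \<inter> W lam (Suc k))
          = ennreal ((1 - q) * q ^ k)"
        using emeasure_W[of "Suc k"] acip_density_nonneg[of "Suc k"]
        by (simp add: ennreal_mult'[symmetric])
    qed
  qed (simp add: sets_leb_unit_iff)
  also have "\<dots> = ennreal 1"
  proof (rule suminf_ennreal_eq)
    show "(\<lambda>k. (1 - q) * q ^ k) sums 1"
      using sums_mult[OF geometric_sums[of q], of "1 - q"] q by simp
  qed (use q in simp)
  finally show "emeasure acip_measure (space acip_measure) = 1"
    by (simp add: acip_measure_def)
qed

text \<open>Pulling back along every branch and exchanging sum and integral yields the transfer
  operator applied to the density, which reproduces the density.\<close>

lemma emeasure_acip_measure_vimage: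
  assumes A: "A \<in> sets leb_unit"
  shows "emeasure acip_measure (F lam -` A \<inter> {0<..1}) = emeasure acip_measure A"
proof -
  have [measurable]: "A \<in> sets borel" using A by (simp add: sets_leb_unit_iff)
  have "F lam -` A \<in> sets borel" using measurable_sets[of "F lam" borel borel A] by simp
  then have FA: "F lam -` A \<inter> {0<..1} \<in> sets leb_unit" by (simp add: sets_leb_unit_iff)
  let ?c = "\<lambda>n. acip_density (Suc n) * inv_slope lam (Suc n)"
  have c: "0 \<le> ?c n" for n
    using acip_density_nonneg inv_slope_pos[of "Suc n"] by simp
  have pointwise: "(\<Sum>n. ennreal (?c n) * indicator {0<..lam ^ (n - 1)} x)
      = ennreal (acip_density (W_index lam x))" if x: "x \<in> {0<..1}" for x
  proof -
    define k where "k = W_index lam x"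
    have k: "1 \<le> k" "x \<in> W lam k" using W_index_W[OF x] by (auto simp: k_def)
    \<comment> \<open>The cell \<open>Suc n\<close> has image \<open>{0<..lam ^ (n - 1)}\<close>,
      also for \<open>n = 0\<close> by truncation. A point of the \<open>k\<close>-th cell lies in
      exactly those images with \<open>n \<le> k\<close>.\<close>
    have mem: "x \<in> {0<..lam ^ (n - 1)} \<longleftrightarrow> n \<le> k" for n
    proof
      assume "x \<in> {0<..lam ^ (n - 1)}"
      then have "lam ^ k < lam ^ (n - 1)" using k by (auto simp: W_def)
      then show "n \<le> k" using lam_pos lam_less1 by (simp add: power_strict_decreasing_iff)
    next
      assume "n \<le> k"
      then have "n - 1 < k" using k by linarith
      then show "x \<in> {0<..lam ^ (n - 1)}"
        using W_subset_initial k by blast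
    qed
    have ind: "indicator {0<..lam ^ (n - 1)} x = (if n \<le> k then 1 else 0 :: ennreal)" for n
      unfolding indicator_def mem by simp
    have "(\<Sum>n. ennreal (?c n) * indicator {0<..lam ^ (n - 1)} x) = (\<Sum>n\<le>k. ennreal (?c n))"
      unfolding ind by (subst suminf_finite[of "{..k}"]) auto
    also have "\<dots> = ennreal (\<Sum>n\<le>k. ?c n)" by (rule sum_ennreal) (rule c)
    finally show ?thesis using sum_acip_density[OF k(1)] by (simp add: k_def)
  qed
  have "emeasure acip_measure (F lam -` A \<inter> {0<..1})
      = (\<Sum>n. ennreal (acip_density (Suc n)) * emeasure lborel (F lam -` A \<inter> W lam (Suc n)))"
  proof -
    have "F lam -` A \<inter> {0<..1} \<inter> W lam (Suc n) = F lam -` A \<inter> W lam (Suc n)" for n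
      using W_subset_unit[of "Suc n"] by auto
    then show ?thesis by (simp add: emeasure_acip_measure[OF FA])
  qed
  also have "\<dots> = (\<Sum>n. \<integral>\<^sup>+x. ennreal (?c n) * indicator {0<..lam ^ (n - 1)} x * indicator A x \<partial>lborel)"
  proof (rule suminf_cong)
    fix n
    have "ennreal (acip_density (Suc n)) * emeasure lborel (F lam -` A \<inter> W lam (Suc n))
        = ennreal (?c n) * emeasure lborel (A \<inter> {0<..lam ^ (n - 1)})"
      using emeasure_F_vimage_W[of A "Suc n"] acip_density_nonneg
      by (simp add: ennreal_mult' mult.assoc)
    also have "\<dots> = (\<integral>\<^sup>+x. ennreal (?c n) * indicator (A \<inter> {0<..lam ^ (n - 1)}) x \<partial>lborel)"
      by (rule nn_integral_cmult_indicator[symmetric]) simp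
    also have "\<dots> = (\<integral>\<^sup>+x. ennreal (?c n) * indicator {0<..lam ^ (n - 1)} x * indicator A x \<partial>lborel)"
      by (intro nn_integral_cong) (auto split: split_indicator)
    finally show "ennreal (acip_density (Suc n)) * emeasure lborel (F lam -` A \<inter> W lam (Suc n))
        = (\<integral>\<^sup>+x. ennreal (?c n) * indicator {0<..lam ^ (n - 1)} x * indicator A x \<partial>lborel)" .
  qed
  also have "\<dots> = (\<integral>\<^sup>+x. (\<Sum>n. ennreal (?c n) * indicator {0<..lam ^ (n - 1)} x * indicator A x) \<partial>lborel)"
    by (rule nn_integral_suminf[symmetric]) simp
  also have "\<dots> = (\<integral>\<^sup>+x. ennreal (acip_density (W_index lam x)) * indicator A x \<partial>lborel)"
  proof (rule nn_integral_cong)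
    fix x
    show "(\<Sum>n. ennreal (?c n) * indicator {0<..lam ^ (n - 1)} x * indicator A x)
        = ennreal (acip_density (W_index lam x)) * indicator A x"
      unfolding ennreal_suminf_multc using A pointwise[of x]
      by (cases "x \<in> A") (auto simp: sets_leb_unit_iff)
  qed
  also have "\<dots> = emeasure acip_measure A"
    by (rule emeasure_acip_measure_nn[OF A, symmetric])
  finally show ?thesis .
qed

lemma acip_acip_measure: "acip leb_unit (F lam) acip_measure"
proof -
  have sets: "sets acip_measure = sets leb_unit" by (simp add: acip_measure_def)
  have space: "space acip_measure = {0<..1}" by (simp add: acip_measure_def)
  have F: "F lam \<in> measurable acip_measure acip_measure"
    using F_measurable_leb_unit measurable_cong_sets[OF sets sets] by blast
  have "distr acip_measure acip_measure (F lam) = acip_measure"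
  proof (rule measure_eqI)
    fix A assume "A \<in> sets (distr acip_measure acip_measure (F lam))"
    then show "emeasure (distr acip_measure acip_measure (F lam)) A = emeasure acip_measure A"
      using emeasure_acip_measure_vimage[of A] by (simp add: emeasure_distr[OF F] space sets)
  qed simp
  moreover have "absolutely_continuous leb_unit acip_measure"
    unfolding acip_measure_def by (intro absolutely_continuousI_density measurable_leb_unit) measurable
  ultimately show ?thesis
    using prob_space_acip_measure sets F by (simp add: acip_def invariant_measure_def)
qed

end

end

theorem theorem1:
  fixes lam :: real
  assumes "0 < lam" and "lam < 1"
  shows "((\<exists>\<mu>. acip leb_unit (F lam) \<mu>) \<longleftrightarrow> lam \<in> {0<..<1/2}) \<and>
    (lam \<in> {0<..<1/2} \<longrightarrow>
      (\<forall>\<mu>. acip leb_unit (F lam) \<mu> \<longrightarrow>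
        (\<forall>i\<ge>1. measure \<mu> (W lam i) = (1 - 2 * lam) / lam * (lam / (1 - lam)) ^ i))) \<and>
    (lam \<in> {1/2<..<1} \<longrightarrow> dissipative leb_unit (F lam))"
proof (intro conjI iffI impI allI)
  show "lam \<in> {0<..<1/2}" if "\<exists>\<mu>. acip leb_unit (F lam) \<mu>"
    using that acip_measure_W(1)[OF assms] assms by auto
  show "\<exists>\<mu>. acip leb_unit (F lam) \<mu>" if "lam \<in> {0<..<1/2}"
    using that acip_acip_measure[OF assms] by auto
  show "measure \<mu> (W lam i) = (1 - 2 * lam) / lam * (lam / (1 - lam)) ^ i"
    if "acip leb_unit (F lam) \<mu>" "1 \<le> i" for \<mu> i
    using that by (rule acip_measure_W(2)[OF assms])
  show "dissipative leb_unit (F lam)" if "lam \<in> {1/2<..<1}"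
    using that by (intro dissipative_F[OF assms]) simp
qed

end
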